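(* For every fixed integer $k\ge 3$, as $n\to\infty$, \[ f(n,k)=\Theta_k(L_k(n)),\qquad c(n,k)=\log_2 L_k(n)+O_k(1). \] It follows that $f(n,k)=\Theta_k\bigl(2^{c(n,k)}\bigr)$.
   Context: All hypergraphs are finite and simple. For an integer $k\ge 2$, a $k$-uniform hypergraph is a pair $H=(V(H),E(H))$ with $E(H)\subseteq\binom{V(H)}{k}$. A set $X\subseteq V(H)$ is complete if every $k$-element subset of $X$ belongs to $E(H)$ (so every set with fewer than $k$ vertices is complete). A maximal clique is a complete set that is maximal under inclusion. Define \[ g(n,k)=\max_{|V(H)|=n}\bigl|\{|X|: X\text{ is a maximal clique of }H\}\bigr|,\qquad f(n,k)=n-g(n,k), \] the maximum being over all $n$-vertex $k$-uniform hypergraphs $H$. Put $K=16$ and, for real $x\ge 0$, define \[ L_2(x)=\max\{2,\log_2(\max\{1,x\})\},\qquad L_j(x)=\min\{t\in\mathbb Z_{\ge0}: L_{j-1}^{\circ t}(x)\le K\}\quad(j\ge 3), \] where $F^{\circ t}$ denotes $t$ repeated applications of $F$ and $F^{\circ 0}(x)=x$. For nonnegative integers $d,C$, a $(d,C)$-layered tree is a (finite) rooted tree $T$ together with an ordering $v_0,v_1,\ldots,v_{N-1}$ of its vertices such that $v_0$ is the root, every vertex has depth at most $d$, the parent of $v_i$ precedes $v_i$ for each $i>0$, and $\deg_T(v_i)\le 2^{C+i}$ for $0\le i<N$. Let $N_0(d,C)$ be the largest number of vertices of a $(d,C)$-layered tree (this maximum is finite). Define \[ c(n,k)=\min\{C\in\mathbb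 Z_{\ge0}: n-C\le N_0(k-1,C)\}. \] In $\Theta_k$ and $O_k$, $n\to\infty$ with $k$ fixed, and implied constants depend only on $k$. *)

theory Defs
  imports Complex_Main "HOL-Library.Landau_Symbols"
begin

section \<open>Uniform hypergraphs and maximal clique sizes\<close>

definition uniform_hypergraph :: "nat \<Rightarrow> 'a set \<Rightarrow> 'a set set \<Rightarrow> bool" where
  "uniform_hypergraph k V E \<longleftrightarrow> finite V \<and> (\<forall>e\<in>E. e \<subseteq> V \<and> card e = k)"

definition complete_set :: "nat \<Rightarrow> 'a set \<Rightarrow> 'a set set \<Rightarrow> 'a set \<Rightarrow> bool" where
  "complete_set k V E X \<longleftrightarrow> X \<subseteq> V \<and> (\<forall>Y. Y \<subseteq> X \<and> card Y = k \<longrightarrow> Y \<in> E)"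

definition maximal_clique :: "nat \<Rightarrow> 'a set \<Rightarrow> 'a set set \<Rightarrow> 'a set \<Rightarrow> bool" where
  "maximal_clique k V E X \<longleftrightarrow>
     complete_set k V E X \<and> (\<forall>Y. complete_set k V E Y \<and> X \<subseteq> Y \<longrightarrow> Y = X)"

definition clique_sizes :: "nat \<Rightarrow> 'a set \<Rightarrow> 'a set set \<Rightarrow> nat set" where
  "clique_sizes k V E = card ` {X. maximal_clique k V E X}"

text \<open>Every finite hypergraph is isomorphic to one whose vertices are natural numbers, so
  it suffices to let the maximum range over vertex sets of that type.\<close>

definition g_num :: "nat \<Rightarrow> nat \<Rightarrow> nat" where
  "g_num n k = Max {card (clique_sizes k V E) | (V :: nat set) E.
                      uniform_hypergraph k V E \<and> card V = n}"

text \<open>Integer-valued, since \<open>g_num 0 k = 1\<close>.\<close>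

definition f_num :: "nat \<Rightarrow> nat \<Rightarrow> int" where
  "f_num n k = int n - int (g_num n k)"


section \<open>The iterated logarithm hierarchy\<close>

definition K_bound :: real where
  "K_bound = 16"

primrec L_shift :: "nat \<Rightarrow> real \<Rightarrow> real" where
  "L_shift 0 = (\<lambda>x. max 2 (log 2 (max 1 x)))"
| "L_shift (Suc m) = (\<lambda>x. real (LEAST t. (L_shift m ^^ t) x \<le> K_bound))"

text \<open>The hierarchy starts at index 2; the values at indices 0 and 1 are meaningless.\<close>

definition L_fun :: "nat \<Rightarrow> real \<Rightarrow> real" where
  "L_fun j = L_shift (j - 2)"

lemma L_fun_2: "L_fun 2 x = max 2 (log 2 (max 1 x))"
  by (simp add: L_fun_def)

lemma L_fun_rec:
  assumes "j \<ge> 3"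
  shows "L_fun j x = real (LEAST t. (L_fun (j - 1) ^^ t) x \<le> K_bound)"
proof -
  from assms have "j - 2 = Suc (j - 1 - 2)" by simp
  then show ?thesis by (simp add: L_fun_def)
qed


section \<open>Layered trees\<close>

definition adj :: "'a set set \<Rightarrow> ('a \<times> 'a) set" where
  "adj E = {(u, v). {u, v} \<in> E}"

definition graph_cycle :: "'a set set \<Rightarrow> 'a list \<Rightarrow> bool" where
  "graph_cycle E p \<longleftrightarrow> length p \<ge> 3 \<and> distinct p \<and>
     (\<forall>i<length p. (p ! i, p ! (Suc i mod length p)) \<in> adj E)"

definition finite_tree :: "'a set \<Rightarrow> 'a set set \<Rightarrow> bool" where
  "finite_tree V E \<longleftrightarrow> uniform_hypergraph 2 V E \<and> V \<noteq> {} \<and>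
     (\<forall>u\<in>V. \<forall>v\<in>V. (u, v) \<in> (adj E)\<^sup>*) \<and> (\<nexists>p. graph_cycle E p)"

definition degree_in :: "'a set set \<Rightarrow> 'a \<Rightarrow> nat" where
  "degree_in E v = card {e \<in> E. v \<in> e}"

text \<open>Depth is the distance from the root \<open>r\<close>, and the parent of \<open>v\<close> is the neighbour
  of \<open>v\<close> one step closer to the root.\<close>

definition depth_in :: "'a set set \<Rightarrow> 'a \<Rightarrow> 'a \<Rightarrow> nat" where
  "depth_in E r v = (LEAST m. (r, v) \<in> adj E ^^ m)"

definition parent_of :: "'a set set \<Rightarrow> 'a \<Rightarrow> 'a \<Rightarrow> 'a \<Rightarrow> bool" where
  "parent_of E r u v \<longleftrightarrow> (u, v) \<in> adj E \<and> depth_in E r v = Suc (depth_in E r u)"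

definition layered_tree ::
    "nat \<Rightarrow> nat \<Rightarrow> 'a set \<Rightarrow> 'a set set \<Rightarrow> 'a \<Rightarrow> 'a list \<Rightarrow> bool" where
  "layered_tree d C V E r vs \<longleftrightarrow>
     finite_tree V E \<and> r \<in> V \<and>
     distinct vs \<and> set vs = V \<and> vs ! 0 = r \<and>
     (\<forall>v\<in>V. depth_in E r v \<le> d) \<and>
     (\<forall>i<length vs. i > 0 \<longrightarrow> (\<forall>u. parent_of E r u (vs ! i) \<longrightarrow> (\<exists>j<i. vs ! j = u))) \<and>
     (\<forall>i<length vs. degree_in E (vs ! i) \<le> 2 ^ (C + i))"

definition N0 :: "nat \<Rightarrow> nat \<Rightarrow> nat" where
  "N0 d C = Max {card V | (V :: nat set) E r vs. layered_tree d C V E r vs}"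

definition c_num :: "nat \<Rightarrow> nat \<Rightarrow> nat" where
  "c_num n k = (LEAST C. int n - int C \<le> int (N0 (k - 1) C))"

end

theory Submission
  imports Defs
begin

text \<open>
  Write \<open>i = k - 3\<close>, so that \<open>L_k\<close> is \<open>L_shift (Suc i)\<close>, which counts the steps of \<open>L_shift i\<close>. Two
  hierarchies of growth functions mirror the iterated logarithms: \<open>slow\<close> starts with \<open>2 ^ y\<close>, \<open>fast\<close>
  starts with a threefold exponential, and in both the next level iterates the previous one. Five
  steps of \<open>L_shift i\<close> undo one application of \<open>fast i\<close> (\<open>L_shift_fast\<close>), and two applications of \<open>slow i\<close>
  make up for one step of \<open>L_shift i\<close> (\<open>slow_catches_up\<close>). Hence both \<open>f(n,k)\<close> and \<open>2 ^ c(n,k)\<close> are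
  of order \<open>L_k(n)\<close> as soon as each of them is, up to constants, between the numbers of iterations
  of \<open>fast i\<close> and of \<open>slow i\<close> that are needed to reach \<open>n\<close>.

  Lower bounds. Both are instances of one counting scheme (\<open>epoch_bound\<close>): time is cut into epochs at
  the few moments when something of a new kind appears, each epoch is cut again with respect to the
  next kind, and the number of cuts is bounded in terms of the starting time of the epoch. For a
  layered tree, time is the position in the ordering and the kinds are the depths: inside an epoch
  without vertices of depth at most \<open>j\<close>, those of depth \<open>j + 1\<close> are children of vertices that precede
  the epoch. The root allows \<open>2 ^ C\<close> cuts. For a hypergraph, time is the number of vertices that a
  maximal clique misses. Consider the set of all vertices missed by some early clique, and suppose
  that all small parts of the trace of a later clique on such sets lie inside early cliques. Then
  every \<open>k\<close>-set with at most \<open>k - 2\<close> vertices in the set, all of them in the trace, is contained in an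
  early clique, and so the later clique is determined by its trace (\<open>covered_determines\<close>). A cut
  occurs when a trace contains a new \<open>j\<close>-element set. The first cuts concern single vertices missed by the
  largest clique, of which there are at most \<open>f(n,k)\<close>.

  Upper bounds. For trees, one appends vertices greedily and completes the subtree of each child
  before the next child is appended (\<open>grow_subtrees\<close>). For hypergraphs, one takes a complete base
  and \<open>r\<close> further vertices, no two of which are in a common edge, with prescribed
  \<open>(k - 1)\<close>-uniform links on the base (\<open>realizable_cone\<close>). The sizes realized by the links are
  arranged in consecutive intervals. Starting from graphs whose complements are disjoint unions of
  stars, this realizes all but \<open>r + O(1)\<close> sizes if \<open>r\<close> iterations of \<open>slow i\<close> reach \<open>n\<close>.
\<close>

section \<open>The iterated logarithms and two growth hierarchies\<close>

lemma log2_le_minus_one: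
  fixes x :: real
  assumes "x \<ge> 2"
  shows "log 2 x \<le> x - 1"
proof -
  have "ln (1 / 2 :: real) \<le> 1 / 2 - 1" by (rule ln_le_minus_one) simp
  then have ln2: "1 / 2 \<le> ln (2 :: real)" by (simp add: ln_div)
  have "ln (x / 2) \<le> x / 2 - 1" using assms by (intro ln_le_minus_one) auto
  then have "ln x \<le> x / 2 - 1 + ln 2" using assms by (simp add: ln_div)
  also have "\<dots> \<le> (x - 1) * ln 2"
  proof -
    have "(x - 2) * (1/2) \<le> (x - 2) * ln 2"
      using assms ln2 by (intro mult_left_mono) auto
    then show ?thesis by (simp add: algebra_simps diff_divide_distrib)
  qed
  finally show ?thesis by (simp add: log_def field_simps)
qed

lemma funpow_contract_to_16:
  fixes L :: "real \<Rightarrow> real"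
  assumes "\<And>x. x > 16 \<Longrightarrow> L x \<le> x - 1" and "\<And>x. x \<le> 16 \<Longrightarrow> L x \<le> 16"
  shows "(L ^^ t) x \<le> max 16 (x - real t)"
proof (induction t)
  case (Suc t)
  show ?case
  proof (cases "(L ^^ t) x > 16")
    case True
    then have "(L ^^ Suc t) x \<le> (L ^^ t) x - 1" using assms(1) by simp
    then show ?thesis using Suc True by (simp add: max_def split: if_splits)
  next
    case False
    then show ?thesis using assms(2)[of "(L ^^ t) x"] by simp
  qed
qed simp

lemma L_shift_contracts:
  "(x > 16 \<longrightarrow> L_shift i x \<le> x - 1) \<and> (x \<le> 16 \<longrightarrow> L_shift i x \<le> 16)"
proof (induction i arbitrary: x)
  case 0
  have "log 2 (max 1 x) \<le> 16" if "x \<le> 16"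
  proof (cases "x \<le> 2")
    case True
    then have "log 2 (max 1 x) \<le> log 2 2" by (subst log_le_cancel_iff) auto
    also have "\<dots> \<le> 16" by simp
    finally show ?thesis .
  next
    case False
    then show ?thesis using log2_le_minus_one[of x] that by (simp add: max_def)
  qed
  then show ?case using log2_le_minus_one[of x] by (auto simp: max_def)
next
  case (Suc i)
  define t where "t = nat \<lceil>x - 16\<rceil>"
  have "(L_shift i ^^ t) x \<le> max 16 (x - real t)"
    using Suc by (intro funpow_contract_to_16) auto
  also have "\<dots> \<le> 16" unfolding t_def by linarith
  finally have "(LEAST t. (L_shift i ^^ t) x \<le> K_bound) \<le> t"
    by (intro Least_le) (simp add: K_bound_def)
  then have "L_shift (Suc i) x \<le> real t" by simp
  then show ?case unfolding t_def by linarith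
qed

lemma L_shift_funpow_le: "(L_shift i ^^ t) x \<le> max 16 (x - real t)"
  using L_shift_contracts by (intro funpow_contract_to_16) auto

text \<open>The defining minimum becomes a Galois connection because \<open>{x. x \<le> 16}\<close> is closed
  under every \<open>L_shift i\<close>.\<close>

lemma L_shift_Suc_le_iff: "L_shift (Suc i) x \<le> real t \<longleftrightarrow> (L_shift i ^^ t) x \<le> 16"
proof -
  define P where "P = (\<lambda>t. (L_shift i ^^ t) x \<le> 16)"
  have closed: "P (t + s)" if "P t" for t s
    using that L_shift_funpow_le[of s i "(L_shift i ^^ t) x"]
    by (simp add: P_def funpow_add add.commute[of t])
  have "P (nat \<lceil>x\<rceil>)"
    using L_shift_funpow_le[where i = i and t = "nat \<lceil>x\<rceil>" and x = x] unfolding P_def by linarith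
  then have "P (LEAST t. P t)" by (rule LeastI)
  then have "(LEAST t. P t) \<le> t \<longleftrightarrow> P t"
    using closed[of "LEAST t. P t" "t - (LEAST t. P t)"] Least_le[of P t] by auto
  then show ?thesis by (simp add: P_def K_bound_def)
qed

lemma L_shift_nonneg: "L_shift i x \<ge> 0"
  by (cases i) auto

lemma L_shift_Suc_nat: "\<exists>t. L_shift (Suc i) x = real t"
  by simp

lemma L_shift_mono: "mono (L_shift i)"
proof (induction i)
  case 0
  show ?case
  proof (rule monoI)
    fix x y :: real assume "x \<le> y"
    then have "log 2 (max 1 x) \<le> log 2 (max 1 y)" by (subst log_le_cancel_iff) auto
    then have "max 2 (log 2 (max 1 x)) \<le> max 2 (log 2 (max 1 y))" by (rule max.mono[OF order_refl])
    then show "L_shift 0 x \<le> L_shift 0 y" by simp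
  qed
next
  case (Suc i)
  show ?case
  proof (rule monoI)
    fix x y :: real assume xy: "x \<le> y"
    obtain t where t: "L_shift (Suc i) y = real t" using L_shift_Suc_nat by blast
    have "(L_shift i ^^ t) x \<le> (L_shift i ^^ t) y" by (rule funpow_mono[OF Suc xy])
    also have "\<dots> \<le> 16" using t L_shift_Suc_le_iff by (metis order_refl)
    finally show "L_shift (Suc i) x \<le> L_shift (Suc i) y"
      using t L_shift_Suc_le_iff by simp
  qed
qed

lemma L_shift_ge_one: "x > 16 \<Longrightarrow> L_shift i x \<ge> 1"
proof (cases i)
  case (Suc j)
  assume "x > 16"
  then have "\<not> L_shift (Suc j) x \<le> real 0" by (subst L_shift_Suc_le_iff) simp
  moreover obtain t where "L_shift (Suc j) x = real t" using L_shift_Suc_nat by blast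
  ultimately show ?thesis using Suc by simp
qed simp

text \<open>Counting the steps of \<open>L_shift i\<close> after the first one costs at most as much as the value reached
  by that first step.\<close>

lemma L_shift_Suc_le: "L_shift (Suc i) x \<le> L_shift i x"
proof (cases "x > 16")
  case False
  then have "L_shift (Suc i) x \<le> real 0" by (subst L_shift_Suc_le_iff) simp
  then show ?thesis using L_shift_nonneg[of i x] by linarith
next
  case True
  define u where "u = L_shift i x"
  obtain t where t: "L_shift (Suc i) u = real t" using L_shift_Suc_nat by blast
  then have "(L_shift i ^^ t) u \<le> 16" using L_shift_Suc_le_iff by (metis order_refl)
  then have "(L_shift i ^^ Suc t) x \<le> 16" by (simp add: u_def funpow_swap1)
  then have *: "L_shift (Suc i) x \<le> real (Suc t)" by (subst L_shift_Suc_le_iff)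
  show ?thesis
  proof (cases "u > 16")
    case True
    then have "L_shift (Suc i) u \<le> u - 1" using L_shift_contracts by blast
    then show ?thesis using * t u_def by simp
  next
    case False
    then have "(L_shift i ^^ Suc 0) x \<le> 16" by (simp add: u_def)
    then have "L_shift (Suc i) x \<le> real (Suc 0)" by (subst L_shift_Suc_le_iff)
    then show ?thesis using L_shift_ge_one[OF \<open>x > 16\<close>, of i] by simp
  qed
qed

lemma L_shift_funpow_le_0: "(L_shift i ^^ t) x \<le> (L_shift 0 ^^ t) x"
proof (induction t)
  case (Suc t)
  have le: "L_shift i z \<le> L_shift 0 z" for z
    by (induction i) (use L_shift_Suc_le order_trans in blast)+
  have "(L_shift i ^^ Suc t) x \<le> L_shift 0 ((L_shift i ^^ t) x)" using le by simp
  also have "\<dots> \<le> L_shift 0 ((L_shift 0 ^^ t) x)" by (rule monoD[OF L_shift_mono Suc])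
  finally show ?case by simp
qed simp

text \<open>The hierarchy \<open>fast\<close> bounds from above what the counting arguments produce, \<open>slow\<close> bounds from
  below what the constructions produce. Their initial functions and iteration counts are quite
  different, but \<open>L_shift\<close> cannot tell them apart up to constant factors. Three exponentials are
  generous enough to swallow every polynomial and every binomial coefficient that occurs below.\<close>

definition tower3 :: "nat \<Rightarrow> nat" where
  "tower3 y = 2 ^ (2 ^ (2 ^ y))"

primrec fast :: "nat \<Rightarrow> nat \<Rightarrow> nat" where
  "fast 0 = tower3"
| "fast (Suc i) = (\<lambda>y. (fast i ^^ tower3 y) y)"

primrec slow :: "nat \<Rightarrow> nat \<Rightarrow> nat" where
  "slow 0 = (\<lambda>y. 2 ^ y)"
| "slow (Suc i) = (\<lambda>r. (slow i ^^ r) 1)"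

lemma le_funpow:
  fixes f :: "nat \<Rightarrow> nat"
  assumes "\<And>y. y \<le> f y"
  shows "y \<le> (f ^^ t) y"
  by (induction t) (use assms order_trans in \<open>auto\<close>)

lemma funpow_le_funpow:
  fixes f :: "nat \<Rightarrow> nat"
  assumes "mono f" "\<And>y. y \<le> f y" "s \<le> t" "x \<le> y"
  shows "(f ^^ s) x \<le> (f ^^ t) y"
proof -
  have "(f ^^ s) x \<le> (f ^^ s) ((f ^^ (t - s)) y)"
    using le_funpow[of f y "t - s"] assms by (intro funpow_mono) auto
  also have "\<dots> = (f ^^ t) y"
    using assms(3) by (simp flip: funpow_add[THEN fun_cong, unfolded o_def])
  finally show ?thesis .
qed

lemma Suc_le_two_pow: "Suc y \<le> 2 ^ y"
  by (simp add: Suc_le_eq)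

lemma le_tower3: "y \<le> tower3 y"
  unfolding tower3_def by (meson Suc_le_two_pow Suc_leD order_trans)

lemma tower3_mono: "mono tower3"
  by (intro monoI) (simp add: tower3_def)

lemma fast_mono_le: "mono (fast i) \<and> (\<forall>y. y \<le> fast i y)"
proof (induction i)
  case 0
  then show ?case using tower3_mono le_tower3 by simp
next
  case (Suc i)
  then show ?case
    by (auto intro!: monoI funpow_le_funpow le_funpow monoD[OF tower3_mono])
qed

lemmas fast_mono = fast_mono_le[THEN conjunct1]
lemmas le_fast = fast_mono_le[THEN conjunct2, rule_format]

lemma slow_mono_ge: "mono (slow i) \<and> (\<forall>y. 2 ^ y \<le> slow i y)"
proof (induction i)
  case 0
  then show ?case by (auto intro!: monoI)
next
  case (Suc i)
  have le: "y \<le> slow i y" for y using Suc Suc_le_two_pow Suc_leD order_trans by meson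
  have "2 ^ y \<le> (slow i ^^ y) 1" for y
  proof (induction y)
    case (Suc y)
    have "2 * x \<le> 2 ^ x" if "x \<ge> 1" for x :: nat
      using that Suc_le_two_pow[of "x - 1"] by (cases x) auto
    then have "2 * (slow i ^^ y) 1 \<le> slow i ((slow i ^^ y) 1)"
      using \<open>mono (slow i) \<and> _\<close> Suc order_trans
      by (metis le_funpow le)
    then show ?case using Suc by simp
  qed simp
  moreover have "mono (slow (Suc i))"
    using Suc le by (auto intro!: monoI funpow_le_funpow)
  ultimately show ?case by simp
qed

lemmas slow_mono = slow_mono_ge[THEN conjunct1]
lemmas slow_ge = slow_mono_ge[THEN conjunct2, rule_format]

lemma le_slow: "y \<le> slow i y"
  using slow_ge Suc_le_two_pow Suc_leD order_trans by meson

lemma L_shift_0_two_pow: "y \<ge> 2 \<Longrightarrow> L_shift 0 (2 ^ y) = real y"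
  by simp

text \<open>If five steps of \<open>L_shift i\<close> undo \<open>fast i\<close>, then \<open>5 * r\<close> steps descend from \<open>(fast i ^^ r) y\<close> to
  \<open>y\<close>, and \<open>y\<close> more steps, each of which lowers a value above \<open>16\<close> by at least one, reach \<open>16\<close>.\<close>

lemma L_shift_fast_funpow:
  assumes "\<And>y. y \<ge> 16 \<Longrightarrow> (L_shift i ^^ 5) (real (fast i y)) \<le> real y" and "y \<ge> 16"
  shows "L_shift (Suc i) (real ((fast i ^^ r) y)) \<le> real (5 * r + y)"
proof -
  have ge: "(fast i ^^ r) y \<ge> 16" for r
    using le_funpow[of "fast i" y r] le_fast assms(2) order_trans by blast
  have undo: "(L_shift i ^^ (5 * r)) (real ((fast i ^^ r) y)) \<le> real y"
  proof (induction r)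
    case (Suc r)
    have "(L_shift i ^^ 5) (real ((fast i ^^ Suc r) y)) \<le> real ((fast i ^^ r) y)"
      using assms(1)[OF ge] by simp
    from funpow_mono[OF L_shift_mono this, of "5 * r" i] Suc
    have "(L_shift i ^^ (5 * r)) ((L_shift i ^^ 5) (real ((fast i ^^ Suc r) y))) \<le> real y"
      by linarith
    moreover have "5 * Suc r = 5 * r + 5" by simp
    ultimately show ?case by (simp only: funpow_add o_def)
  qed simp
  have "(L_shift i ^^ (y + 5 * r)) (real ((fast i ^^ r) y)) \<le> (L_shift i ^^ y) (real y)"
    using funpow_mono[OF L_shift_mono undo] by (simp only: funpow_add o_def)
  also have "\<dots> \<le> 16" using L_shift_funpow_le[of y i "real y"] by simp
  finally show ?thesis by (subst L_shift_Suc_le_iff) (simp only: add.commute)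
qed

text \<open>At level \<open>0\<close> three logarithms undo \<open>tower3\<close>. At the next level one step of \<open>L_shift (Suc i)\<close> counts
  the iterations and leaves at most \<open>5 * tower3 y + y\<close>, which is below the square of \<open>tower3 y\<close>; since
  every \<open>L_shift\<close> is dominated by the logarithm, four logarithms bring this square down to \<open>y\<close>. So the
  number five reproduces itself and serves all levels.\<close>

lemma L_shift_fast: "y \<ge> 16 \<Longrightarrow> (L_shift i ^^ 5) (real (fast i y)) \<le> real y"
proof (induction i arbitrary: y)
  case 0
  have ge: "2 \<le> (2::nat) ^ y" "2 \<le> (2::nat) ^ 2 ^ y"
    using 0 Suc_le_two_pow[of y] Suc_le_two_pow[of "2 ^ y"] by linarith+
  have "L_shift 0 (real (2 ^ 2 ^ 2 ^ y)) = real (2 ^ 2 ^ y)"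
    using L_shift_0_two_pow[OF ge(2)] by (simp only: of_nat_power of_nat_numeral)
  moreover have "L_shift 0 (real (2 ^ 2 ^ y)) = real (2 ^ y)"
    using L_shift_0_two_pow[OF ge(1)] by (simp only: of_nat_power of_nat_numeral)
  moreover have "L_shift 0 (real (2 ^ y)) = real y"
    using L_shift_0_two_pow[of y] 0 by (simp only: of_nat_power of_nat_numeral)
  moreover have "(L_shift 0 ^^ 5) z = (L_shift 0 ^^ 2) (L_shift 0 (L_shift 0 (L_shift 0 z)))" for z
    by (simp add: eval_nat_numeral(2,3) del: L_shift.simps)
  ultimately have "(L_shift 0 ^^ 5) (real (fast 0 y)) = (L_shift 0 ^^ 2) (real y)"
    by (simp only: fast.simps tower3_def)
  also have "\<dots> \<le> max 16 (real y - real 2)" by (rule L_shift_funpow_le)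
  finally show ?case using 0 by simp
next
  case (Suc i)
  have "y \<le> tower3 y" by (rule le_tower3)
  then have big: "5 * tower3 y + y \<le> tower3 y * tower3 y"
    using \<open>y \<ge> 16\<close> mult_le_mono1[of 6 "tower3 y" "tower3 y"] by linarith
  have sq: "tower3 y * tower3 y = 2 ^ 2 ^ (2 ^ y + 1)"
    by (simp only: tower3_def power_add mult_2 power_one_right mult_2_right)
  have ge: "2 \<le> (2::nat) ^ (2 ^ y + 1)" "2 \<le> (2::nat) ^ y + 1" "2 \<le> y + 1"
    using Suc.prems Suc_le_two_pow[of y] Suc_le_two_pow[of "2 ^ y + 1"] by linarith+
  have "L_shift (Suc i) (real (fast (Suc i) y)) \<le> real (tower3 y * tower3 y)"
    using L_shift_fast_funpow[OF Suc.IH \<open>y \<ge> 16\<close>, of "tower3 y"] big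
    by (simp del: L_shift.simps of_nat_mult)
  then have "(L_shift (Suc i) ^^ 4) (L_shift (Suc i) (real (fast (Suc i) y)))
      \<le> (L_shift (Suc i) ^^ 4) (real (tower3 y * tower3 y))"
    by (rule funpow_mono[OF L_shift_mono])
  also have "\<dots> \<le> (L_shift 0 ^^ 4) (real (2 ^ 2 ^ (2 ^ y + 1)))"
    unfolding sq by (rule L_shift_funpow_le_0)
  also have "\<dots> = L_shift 0 (L_shift 0 (real (2 ^ y + 1)))"
  proof -
    have "L_shift 0 (real (2 ^ 2 ^ (2 ^ y + 1))) = real (2 ^ (2 ^ y + 1))"
      using L_shift_0_two_pow[OF ge(1)] by (simp only: of_nat_power of_nat_numeral)
    moreover have "L_shift 0 (real (2 ^ (2 ^ y + 1))) = real (2 ^ y + 1)"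
      using L_shift_0_two_pow[OF ge(2)] by (simp only: of_nat_power of_nat_numeral)
    moreover have "(L_shift 0 ^^ 4) z = L_shift 0 (L_shift 0 (L_shift 0 (L_shift 0 z)))" for z
      by (simp add: eval_nat_numeral(2,3) del: L_shift.simps)
    ultimately show ?thesis by (simp only:)
  qed
  also have "\<dots> \<le> L_shift 0 (L_shift 0 (2 ^ (y + 1)))"
    by (intro monoD[OF L_shift_mono]) simp
  also have "\<dots> = L_shift 0 (real (y + 1))"
    using L_shift_0_two_pow[OF ge(3)] by simp
  also have "\<dots> \<le> real y"
    using L_shift_contracts[of "real (y + 1)" 0] \<open>y \<ge> 16\<close> by simp
  also have "(L_shift (Suc i) ^^ 4) (L_shift (Suc i) z) = (L_shift (Suc i) ^^ 5) z" for z
  proof -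
    have "(5::nat) = Suc 4" by simp
    then show ?thesis by (simp only: funpow_Suc_right o_def)
  qed
  finally show ?case .
qed

lemma L_shift_fast_bound:
  assumes "n \<le> (fast i ^^ r) y" and "y \<ge> 16"
  shows "L_shift (Suc i) (real n) \<le> real (5 * r + y)"
proof -
  have "L_shift (Suc i) (real n) \<le> L_shift (Suc i) (real ((fast i ^^ r) y))"
    using assms(1) by (intro monoD[OF L_shift_mono]) simp
  also have "\<dots> \<le> real (5 * r + y)"
    using assms(2) L_shift_fast by (intro L_shift_fast_funpow)
  finally show ?thesis .
qed

text \<open>Two applications of \<open>slow i\<close> catch up with one logarithm \<open>L_shift i\<close>; the second pays for the
  constants that the bound for level \<open>i\<close> carries.\<close>

lemma slow_catches_up_step:
  assumes "\<And>x z. 2 * L_shift i x + real c \<le> real z \<Longrightarrow> x \<le> real (slow i z)"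
  shows "\<exists>c'. \<forall>x t. L_shift (Suc i) x \<le> real t \<longrightarrow> x \<le> real ((slow i ^^ (2 * t + c')) 1)"
proof -
  define c' where "c' = c + 16"
  have "x \<le> real ((slow i ^^ (2 * t + c')) 1)" if "(L_shift i ^^ t) x \<le> 16" for x t
    using that
  proof (induction t arbitrary: x)
    case 0
    have "c' \<le> (slow i ^^ c') 1" using slow_ge[of c' "Suc i"] Suc_le_two_pow[of c'] by simp
    then show ?case using 0 by (simp add: c'_def)
  next
    case (Suc t)
    define w where "w = (slow i ^^ (2 * t + c')) 1"
    have "2 * t + c' \<le> w"
      using slow_ge[of "2 * t + c'" "Suc i"] Suc_le_two_pow[of "2 * t + c'"] by (simp add: w_def)
    then have c: "c + 16 \<le> w" by (simp add: c'_def)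
    have four: "4 * v \<le> 2 ^ v" if "v \<ge> 4" for v :: nat
      using that by (induction v rule: nat_induct_at_least) auto
    have "L_shift i x \<le> real w"
      using Suc.IH[of "L_shift i x"] Suc.prems by (simp add: w_def funpow_swap1)
    then have "2 * L_shift i x + real c \<le> real (4 * w)" using c by simp
    also have "\<dots> \<le> real (slow i w)"
      using four[of w] c slow_ge[of w i] by (subst of_nat_le_iff) linarith
    finally have "x \<le> real (slow i (slow i w))" by (rule assms)
    then show ?case by (simp add: w_def)
  qed
  then show ?thesis by (auto simp only: L_shift_Suc_le_iff)
qed

text \<open>The affine slack \<open>2 * L + c\<close> is what makes the induction over the levels close: the step produces
  exactly such a bound for the next level.\<close>

lemma slow_catches_up_affine:
  "\<exists>c. \<forall>x z. 2 * L_shift i x + real c \<le> real z \<longrightarrow> x \<le> real (slow i z)"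
proof (induction i)
  case 0
  have "x \<le> real (2 ^ z)" if "2 * L_shift 0 x \<le> real z" for x z
  proof -
    have "log 2 (max 1 x) \<le> real z" using that by simp
    then have "max 1 x \<le> 2 powr real z" by (subst (asm) log_le_iff) auto
    then show ?thesis by (simp add: powr_realpow)
  qed
  then show ?case by (intro exI[of _ 0]) simp
next
  case (Suc i)
  then obtain c where c: "\<And>x z. 2 * L_shift i x + real c \<le> real z \<Longrightarrow> x \<le> real (slow i z)"
    by blast
  obtain c' where c': "\<And>x t. L_shift (Suc i) x \<le> real t \<Longrightarrow> x \<le> real ((slow i ^^ (2 * t + c')) 1)"
    using slow_catches_up_step[OF c] by blast
  have "x \<le> real (slow (Suc i) z)" if z: "2 * L_shift (Suc i) x + real c' \<le> real z" for x z
  proof -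
    obtain t where t: "L_shift (Suc i) x = real t" using L_shift_Suc_nat by blast
    have "2 * t + c' \<le> z" using z unfolding t by linarith
    then have "slow (Suc i) (2 * t + c') \<le> slow (Suc i) z" by (rule monoD[OF slow_mono])
    then show ?thesis using c'[of x t] t by simp
  qed
  then show ?case by blast
qed

lemma slow_catches_up:
  obtains c where "\<And>x t. L_shift (Suc i) x \<le> real t \<Longrightarrow> x \<le> real ((slow i ^^ (2 * t + c)) 1)"
  using slow_catches_up_affine[of i] slow_catches_up_step[of i] by metis

section \<open>Epochs\<close>

text \<open>If \<open>F\<close> bounds how far time can run without meeting a point of \<open>T\<close>, then \<open>T\<close> resets the clock
  \<open>card T\<close> times, so \<open>F\<close> is applied once more than that. The parameter \<open>m\<close> is a global lower bound on
  the arguments at which \<open>F\<close> may be used.\<close>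

lemma bound_by_breaks:
  fixes F :: "nat \<Rightarrow> nat"
  assumes "finite T" and "T \<subseteq> {a<..<b}" and "a \<le> y" and "m \<le> y"
    and "\<And>y. y \<le> F y"
    and "\<And>t b' y. t \<in> insert a T \<Longrightarrow> b' \<le> b \<Longrightarrow> T \<inter> {t<..<b'} = {} \<Longrightarrow> t \<le> y \<Longrightarrow> m \<le> y
           \<Longrightarrow> b' \<le> F y"
  shows "b \<le> (F ^^ Suc (card T)) y"
  using assms
proof (induction "card T" arbitrary: T b)
  case 0
  then have "T = {}" by simp
  then show ?case using 0(7)[of a b y] 0 by simp
next
  case (Suc c)
  have ne: "T \<noteq> {}" using Suc(2) by auto
  define t where "t = Max T"
  have t: "t \<in> T" "\<And>s. s \<in> T \<Longrightarrow> s \<le> t" unfolding t_def using ne Suc(3) by auto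
  have c: "c = card (T - {t})" using Suc(2) t(1) Suc(3) by simp
  have "t \<le> (F ^^ Suc (card (T - {t}))) y"
  proof (rule Suc(1)[OF c])
    show "T - {t} \<subseteq> {a<..<t}" using Suc(4) t by force
    fix t' b' y assume *: "t' \<in> insert a (T - {t})" "b' \<le> t" "(T - {t}) \<inter> {t'<..<b'} = {}"
      "t' \<le> y" "m \<le> y"
    have "t < b" using Suc(4) t(1) by force
    moreover have "t \<notin> {t'<..<b'}" using *(2) by simp
    then have "T \<inter> {t'<..<b'} = {}" using *(3) by blast
    moreover have "t' \<in> insert a T" using * by blast
    ultimately show "b' \<le> F y" using * by (intro Suc(8)) simp_all
  qed (use Suc(3,5,6,7) in simp_all)
  then have le: "t \<le> (F ^^ Suc c) y" using c by simp
  have "y \<le> (F ^^ Suc c) y" using le_funpow Suc(7) by blast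
  then have m: "m \<le> (F ^^ Suc c) y" using Suc(6) by simp
  have "T \<inter> {t<..<b} = {}" using t(2) by force
  then have "b \<le> F ((F ^^ Suc c) y)" using Suc(8)[OF _ order_refl _ le m] t(1) by blast
  then show ?case using Suc(2) by simp
qed

text \<open>Read \<open>P i a b\<close> as: strictly between the times \<open>a\<close> and \<open>b\<close> nothing new appears, except of some kinds
  whose number grows with the rank \<open>i\<close>. An epoch of rank \<open>Suc i\<close> breaks, at the few times when
  something of the next kind is new, into epochs of rank \<open>i\<close>; their number is bounded in terms of
  the starting time only. This is the recursion of \<open>fast\<close>.\<close>

lemma epoch_bound:
  fixes P :: "nat \<Rightarrow> nat \<Rightarrow> nat \<Rightarrow> bool"
  assumes top: "\<And>a b y. P 0 a b \<Longrightarrow> a \<le> y \<Longrightarrow> m \<le> y \<Longrightarrow> b \<le> tower3 y"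
    and split: "\<And>i a b. i < h \<Longrightarrow> P (Suc i) a b \<Longrightarrow>
      \<exists>T. finite T \<and> T \<subseteq> {a<..<b} \<and> (\<forall>y. a \<le> y \<longrightarrow> m \<le> y \<longrightarrow> card T < tower3 y) \<and>
          (\<forall>t\<in>insert a T. \<forall>b'\<le>b. T \<inter> {t<..<b'} = {} \<longrightarrow> P i t b')"
    and "i \<le> h" "P i a b" "a \<le> y" "m \<le> y"
  shows "b \<le> fast i y"
  using assms(3-)
proof (induction i arbitrary: a b y)
  case 0
  then show ?case using top by simp
next
  case (Suc i)
  then obtain T where T: "finite T" "T \<subseteq> {a<..<b}" "card T < tower3 y"
    "\<And>t b'. t \<in> insert a T \<Longrightarrow> b' \<le> b \<Longrightarrow> T \<inter> {t<..<b'} = {} \<Longrightarrow> P i t b'"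
    using split[of i a b] by (metis Suc_le_lessD)
  have "b \<le> (fast i ^^ Suc (card T)) y"
    by (rule bound_by_breaks[OF T(1,2) Suc(4,5) le_fast]) (rule Suc(1)[OF Suc_leD[OF Suc(2)] T(4)])
  also have "\<dots> \<le> (fast i ^^ tower3 y) y"
    using T(3) by (intro funpow_le_funpow fast_mono le_fast) auto
  finally show ?case by simp
qed

lemma le_tower3_quadratic: "2 * y + 1 + 2 ^ (y * y + y + 1) \<le> tower3 y"
proof -
  have "y * y + y + 2 \<le> 2 ^ 2 ^ y"
  proof (induction y)
    case (Suc y)
    have "Suc y * Suc y + Suc y + 2 \<le> 2 * (y * y + y + 2)" by (cases y) auto
    also have "\<dots> \<le> 2 * 2 ^ 2 ^ y" using Suc by simp
    also have "\<dots> \<le> 2 ^ 2 ^ y * 2 ^ 2 ^ y"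
      using Suc_le_two_pow[of "2 ^ y"] by (intro mult_right_mono) (auto intro: order_trans[of _ "Suc (2 ^ y)"])
    also have "\<dots> = 2 ^ 2 ^ Suc y" by (simp add: mult_2 power_add)
    finally show ?case .
  qed simp
  have "2 * y + 1 \<le> 2 ^ (y + 1)" using Suc_le_two_pow[of y] by simp
  also have "\<dots> \<le> 2 ^ (y * y + y + 1)" by (rule power_increasing) auto
  finally have "2 * y + 1 + 2 ^ (y * y + y + 1) \<le> 2 ^ (y * y + y + 2)" by simp
  also have "\<dots> \<le> tower3 y"
    unfolding tower3_def using \<open>y * y + y + 2 \<le> _\<close> by (rule power_increasing) simp
  finally show ?thesis .
qed

section \<open>Layered trees are not too large\<close>

lemma depth_in_relpow:
  assumes "(r, v) \<in> (adj E)\<^sup>*"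
  shows "(r, v) \<in> adj E ^^ depth_in E r v"
  unfolding depth_in_def using assms by (auto simp: rtrancl_power intro: LeastI)

lemma depth_in_le: "(r, v) \<in> adj E ^^ m \<Longrightarrow> depth_in E r v \<le> m"
  unfolding depth_in_def by (rule Least_le)

lemma ex_parent:
  assumes "(r, v) \<in> (adj E)\<^sup>*" and "depth_in E r v = Suc m"
  shows "\<exists>u. parent_of E r u v \<and> depth_in E r u = m"
proof -
  obtain u where u: "(r, u) \<in> adj E ^^ m" "(u, v) \<in> adj E"
    using depth_in_relpow[OF assms(1)] assms(2) by auto
  have "(r, u) \<in> adj E ^^ depth_in E r u"
    using u(1) by (intro depth_in_relpow relpow_imp_rtrancl)
  then have "(r, v) \<in> adj E ^^ Suc (depth_in E r u)" using u(2) by auto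
  then have "Suc m \<le> Suc (depth_in E r u)" using depth_in_le assms(2) by metis
  moreover have "depth_in E r u \<le> m" by (rule depth_in_le[OF u(1)])
  ultimately show ?thesis using u(2) assms(2) by (auto simp: parent_of_def)
qed

lemma card_neighbours_le:
  assumes "finite E" "finite A" "\<And>u. u \<in> A \<Longrightarrow> degree_in E u \<le> D u"
    and "\<And>t. t \<in> T \<Longrightarrow> \<exists>u\<in>A. {u, t} \<in> E"
  shows "card T \<le> (\<Sum>u\<in>A. D u)"
proof -
  have sub: "T \<subseteq> (\<Union>u\<in>A. {t. {u, t} \<in> E})" using assms(4) by blast
  have inj: "inj_on (\<lambda>t. {u, t}) {t. {u, t} \<in> E}" for u by (auto simp: inj_on_def doubleton_eq_iff)
  have img: "(\<lambda>t. {u, t}) ` {t. {u, t} \<in> E} \<subseteq> {e \<in> E. u \<in> e}" for u by auto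
  have fin: "finite {t. {u, t} \<in> E}" for u
    using inj img by (rule inj_on_finite) (use assms(1) in simp)
  have "card T \<le> card (\<Union>u\<in>A. {t. {u, t} \<in> E})" using sub fin assms(2) by (intro card_mono) auto
  also have "\<dots> \<le> (\<Sum>u\<in>A. card {t. {u, t} \<in> E})" by (rule card_UN_le[OF assms(2)])
  also have "\<dots> \<le> (\<Sum>u\<in>A. D u)"
  proof (rule sum_mono)
    fix u assume "u \<in> A"
    have "card {t. {u, t} \<in> E} \<le> degree_in E u"
      unfolding degree_in_def using inj img by (rule card_inj_on_le) (use assms(1) in simp)
    then show "card {t. {u, t} \<in> E} \<le> D u" using assms(3)[OF \<open>u \<in> A\<close>] by simp
  qed
  finally show "card T \<le> (\<Sum>u\<in>A. D u)" .
qed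

text \<open>The epochs of a layered tree: positions in the ordering play the role of time, and an epoch is a
  stretch without vertices of depth at most \<open>j\<close>.\<close>

definition deep_between :: "'a set set \<Rightarrow> 'a \<Rightarrow> 'a list \<Rightarrow> nat \<Rightarrow> nat \<Rightarrow> nat \<Rightarrow> bool" where
  "deep_between E r vs j a b \<longleftrightarrow>
     b \<le> length vs \<and> (\<forall>s. a < s \<and> s < b \<longrightarrow> j < depth_in E r (vs ! s))"

context
  fixes d C :: nat and V :: "'a set" and E r vs
  assumes tree: "layered_tree d C V E r vs"
begin

lemma tree_order: "distinct vs" "set vs = V" "vs ! 0 = r"
  using tree unfolding layered_tree_def by blast+

lemma tree_depth: "s < length vs \<Longrightarrow> depth_in E r (vs ! s) \<le> d"
  using tree nth_mem[of s vs] unfolding layered_tree_def by blast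

lemma tree_parent: "s < length vs \<Longrightarrow> 0 < s \<Longrightarrow> parent_of E r u (vs ! s) \<Longrightarrow> \<exists>i<s. vs ! i = u"
  using tree unfolding layered_tree_def by blast

lemma tree_degree: "s < length vs \<Longrightarrow> degree_in E (vs ! s) \<le> 2 ^ (C + s)"
  using tree unfolding layered_tree_def by blast

lemma tree_reach: "s < length vs \<Longrightarrow> (r, vs ! s) \<in> (adj E)\<^sup>*"
  using tree nth_mem[of s vs] unfolding layered_tree_def finite_tree_def by blast

lemma tree_edges: "finite E"
proof -
  have "finite V" "E \<subseteq> Pow V"
    using tree unfolding layered_tree_def finite_tree_def uniform_hypergraph_def by auto
  then show ?thesis by (meson finite_Pow_iff finite_subset)
qed

text \<open>The parent of a vertex of depth \<open>Suc j\<close> has depth \<open>j\<close> and comes earlier. It cannot lie inside the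
  epoch, so it is among the first \<open>a + 1\<close> vertices, whose degrees are bounded by the definition of a
  layered tree.\<close>

lemma few_children:
  assumes "deep_between E r vs j a b"
  defines "T \<equiv> {s. a < s \<and> s < b \<and> depth_in E r (vs ! s) = Suc j}"
  shows "card T \<le> (\<Sum>i\<le>a. 2 ^ (C + i))"
proof -
  note dist = tree_order(1)
  define A where "A = {i. i \<le> a \<and> i < length vs}"
  have T_len: "s < length vs" if "s \<in> T" for s using that assms by (auto simp: deep_between_def)
  have "card T = card ((!) vs ` T)"
    by (rule card_image[symmetric]) (use T_len dist in \<open>auto simp: inj_on_def nth_eq_iff_index_eq\<close>)
  also have "\<dots> \<le> (\<Sum>u\<in>(!) vs ` A. degree_in E u)"
  proof (rule card_neighbours_le[OF tree_edges])
    show "finite ((!) vs ` A)" by (simp add: A_def)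
    fix v assume "v \<in> (!) vs ` T"
    then obtain s where s: "s \<in> T" "v = vs ! s" by blast
    obtain u where u: "parent_of E r u v" "depth_in E r u = j"
      using ex_parent[OF tree_reach[OF T_len[OF s(1)]], of j] s by (auto simp: T_def)
    obtain i where i: "i < s" "vs ! i = u"
      using tree_parent[OF T_len[OF s(1)], of u] s u(1) by (auto simp: T_def)
    have "\<not> a < i" using assms(1) i u(2) s(1) by (auto simp: deep_between_def T_def)
    then have "i \<in> A" using i T_len[OF s(1)] by (auto simp: A_def)
    then show "\<exists>u\<in>(!) vs ` A. {u, v} \<in> E"
      using i u(1) by (auto simp: parent_of_def adj_def)
  qed simp
  also have "\<dots> = (\<Sum>i\<in>A. degree_in E (vs ! i))"
    by (rule sum.reindex_cong[OF _ refl refl]) (use dist in \<open>auto simp: inj_on_def nth_eq_iff_index_eq A_def\<close>)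
  also have "\<dots> \<le> (\<Sum>i\<in>A. 2 ^ (C + i))"
    using tree_degree by (intro sum_mono) (simp add: A_def)
  also have "\<dots> \<le> (\<Sum>i\<le>a. 2 ^ (C + i))" by (rule sum_mono2) (auto simp: A_def)
  finally show ?thesis .
qed

lemma split_at_depth:
  assumes "deep_between E r vs j a b"
  shows "\<exists>T. finite T \<and> T \<subseteq> {a<..<b} \<and> card T \<le> (\<Sum>i\<le>a. 2 ^ (C + i)) \<and>
          (\<forall>t\<in>insert a T. \<forall>b'\<le>b. T \<inter> {t<..<b'} = {} \<longrightarrow> deep_between E r vs (Suc j) t b')"
proof (intro exI conjI ballI allI impI)
  let ?T = "{s. a < s \<and> s < b \<and> depth_in E r (vs ! s) = Suc j}"
  show "card ?T \<le> (\<Sum>i\<le>a. 2 ^ (C + i))" using few_children[OF assms] .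
  show "finite ?T" by (rule finite_subset[of _ "{..b}"]) auto
  fix t b' assume *: "t \<in> insert a ?T" "b' \<le> b" "?T \<inter> {t<..<b'} = {}"
  show "deep_between E r vs (Suc j) t b'"
    unfolding deep_between_def
  proof (intro conjI allI impI)
    show "b' \<le> length vs" using * assms by (auto simp: deep_between_def)
    fix s assume s: "t < s \<and> s < b'"
    then have "a < s" "s < b" using * by auto
    moreover have "s \<notin> ?T" using * s by auto
    ultimately show "Suc j < depth_in E r (vs ! s)"
      using assms by (auto simp: deep_between_def intro: Suc_lessI)
  qed
qed auto

text \<open>The first split, at the at most \<open>2 ^ C\<close> children of the root, is treated separately from the later
  ones: it starts at position \<open>0\<close>, and its small number of breaks is what keeps the bound
  linear in \<open>2 ^ C\<close> after taking iterated logarithms.\<close>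

lemma layered_tree_bound:
  assumes "d \<ge> 2" and "2 ^ C \<le> y"
  shows "card V \<le> (fast (d - 2) ^^ Suc (2 ^ C)) y"
proof -
  have deg: "(\<Sum>i\<le>a. 2 ^ (C + i)) < (2 :: nat) ^ (y * y + y + 1)" if "a \<le> y" "2 ^ C \<le> y" for a y
  proof -
    have "(\<Sum>i\<le>a. 2 ^ (C + i)) = 2 ^ C * (\<Sum>i\<le>a. (2::nat) ^ i)"
      by (simp add: power_add sum_distrib_left)
    also have "(\<Sum>i\<le>a. (2::nat) ^ i) < 2 ^ Suc a"
      by (induction a) auto
    also have "2 ^ C * (2::nat) ^ Suc a = 2 ^ (C + a + 1)" by (simp add: power_add)
    also have "\<dots> \<le> 2 ^ (y * y + y + 1)"
    proof (rule power_increasing)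
      have "C \<le> y" "y \<ge> 1" using that Suc_le_two_pow[of C] by linarith+
      then show "C + a + 1 \<le> y * y + y + 1" using that by (simp add: add_mono le_trans)
    qed simp
    finally show ?thesis by simp
  qed
  have len: "card V = length vs" "vs \<noteq> []"
    using tree_order distinct_card[of vs] tree unfolding layered_tree_def by auto
  have pos: "0 < depth_in E r (vs ! s)" if "0 < s" "s < length vs" for s
  proof (rule ccontr)
    assume "\<not> ?thesis"
    then have "r = vs ! s" using depth_in_relpow[OF tree_reach[OF that(2)]] by simp
    then show False
      using that tree_order(1,3) nth_eq_iff_index_eq[of vs 0 s] by (cases vs) simp_all
  qed
  have start: "deep_between E r vs 0 0 (length vs)" using pos by (auto simp: deep_between_def)
  obtain T where T: "finite T" "T \<subseteq> {0<..<length vs}" "card T \<le> (\<Sum>i\<le>0. 2 ^ (C + i))"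
    "\<forall>t\<in>insert 0 T. \<forall>b'\<le>length vs. T \<inter> {t<..<b'} = {} \<longrightarrow> deep_between E r vs (Suc 0) t b'"
    using split_at_depth[OF start] by blast
  define P where "P = (\<lambda>i. deep_between E r vs (d - 1 - i))"
  have "length vs \<le> (fast (d - 2) ^^ Suc (card T)) y"
  proof (rule bound_by_breaks[OF T(1,2) _ assms(2) le_fast])
    fix t b' y assume *: "t \<in> insert 0 T" "b' \<le> length vs" "T \<inter> {t<..<b'} = {}" "t \<le> y" "2 ^ C \<le> y"
    show "b' \<le> fast (d - 2) y"
    proof (rule epoch_bound[where P = P and h = "d - 2"])
      \<comment> \<open>In an epoch of rank \<open>0\<close> all vertices have the maximal depth \<open>d\<close>.\<close>
      fix a b y assume P: "P 0 a b" and y: "a \<le> y" "2 ^ C \<le> y"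
      have *: "{s. a < s \<and> s < b \<and> depth_in E r (vs ! s) = Suc (d - 1)} = {a<..<b}"
      proof -
        have "depth_in E r (vs ! s) = Suc (d - 1)" if "a < s" "s < b" for s
        proof -
          have "depth_in E r (vs ! s) \<le> d"
            using tree_depth[of s] P that by (simp add: P_def deep_between_def)
          then show ?thesis using P that \<open>d \<ge> 2\<close> by (auto simp: P_def deep_between_def)
        qed
        then show ?thesis by auto
      qed
      have "card {a<..<b} \<le> (\<Sum>i\<le>a. 2 ^ (C + i))"
        using few_children[OF P[unfolded P_def]] unfolding diff_zero * .
      then have "b \<le> y + 1 + 2 ^ (y * y + y + 1)" using deg[OF y] y by simp
      then show "b \<le> tower3 y" using le_tower3_quadratic[of y] by linarith
    next
      fix i a b assume i: "i < d - 2" and P: "P (Suc i) a b"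
      have "Suc (d - 1 - Suc i) = d - 1 - i" using i by simp
      then obtain T where "finite T" "T \<subseteq> {a<..<b}" and c: "card T \<le> (\<Sum>i\<le>a. 2 ^ (C + i))"
        and "\<forall>t\<in>insert a T. \<forall>b'\<le>b. T \<inter> {t<..<b'} = {} \<longrightarrow> P i t b'"
        using split_at_depth[OF P[unfolded P_def]] unfolding P_def by metis
      moreover have "card T < tower3 y" if "a \<le> y" "2 ^ C \<le> y" for y
        using c deg[OF that] le_tower3_quadratic[of y] by linarith
      ultimately show "\<exists>T. finite T \<and> T \<subseteq> {a<..<b} \<and> (\<forall>y. a \<le> y \<longrightarrow> 2 ^ C \<le> y \<longrightarrow> card T < tower3 y)
          \<and> (\<forall>t\<in>insert a T. \<forall>b'\<le>b. T \<inter> {t<..<b'} = {} \<longrightarrow> P i t b')" by blast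
    next
      have "d - 1 - (d - 2) = Suc 0" using \<open>d \<ge> 2\<close> by simp
      then show "P (d - 2) t b'" unfolding P_def using T(4) *(1-3) by metis
    qed (use * in auto)
  qed simp
  also have "\<dots> \<le> (fast (d - 2) ^^ Suc (2 ^ C)) y"
    using T(3) by (intro funpow_le_funpow fast_mono le_fast) auto
  finally show ?thesis using len by simp
qed

end

lemma layered_tree_singleton: "layered_tree d C {v} {} v [v]"
proof -
  have "adj {} = {}" by (simp add: adj_def)
  moreover have "\<not> graph_cycle {} p" for p :: "'a list"
    using \<open>adj {} = {}\<close> by (cases p) (auto simp: graph_cycle_def)
  moreover have "depth_in {} v v = 0" unfolding depth_in_def by (rule Least_eq_0) simp
  ultimately show ?thesis
    by (auto simp: layered_tree_def finite_tree_def uniform_hypergraph_def degree_in_def)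
qed

lemma
  assumes "d \<ge> 2"
  shows N0_le: "2 ^ C \<le> y \<Longrightarrow> N0 d C \<le> (fast (d - 2) ^^ Suc (2 ^ C)) y"
    and card_le_N0: "layered_tree d C V E r vs \<Longrightarrow> card (V :: nat set) \<le> N0 d C"
proof -
  let ?S = "{card V | (V :: nat set) E r vs. layered_tree d C V E r vs}"
  have le: "?S \<subseteq> {..(fast (d - 2) ^^ Suc (2 ^ C)) y}" if "2 ^ C \<le> y" for y
    using layered_tree_bound[OF _ assms that] by auto
  have fin: "finite ?S" by (rule finite_subset[OF le[OF order_refl]]) simp
  have "card {0 :: nat} \<in> ?S" using layered_tree_singleton[of d C "0 :: nat"] by blast
  then have "?S \<noteq> {}" by blast
  then have "Max ?S \<in> ?S" by (rule Max_in[OF fin])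
  then show "2 ^ C \<le> y \<Longrightarrow> N0 d C \<le> (fast (d - 2) ^^ Suc (2 ^ C)) y"
    using subsetD[OF le, of y "Max ?S"] unfolding N0_def atMost_iff by blast
  show "layered_tree d C V E r vs \<Longrightarrow> card V \<le> N0 d C"
    unfolding N0_def by (rule Max_ge[OF fin]) blast
qed

section \<open>Large layered trees\<close>

definition kids :: "nat \<Rightarrow> (nat \<Rightarrow> nat) \<Rightarrow> nat \<Rightarrow> nat" where
  "kids N p i = card {s. 0 < s \<and> s < N \<and> p s = i}"

definition capacity :: "nat \<Rightarrow> nat \<Rightarrow> nat" where
  "capacity C i = (if i = 0 then 2 ^ C else 2 ^ (C + i) - 1)"

text \<open>A layered tree whose vertices are \<open>0, \<dots>, N - 1\<close> in this order, given by parents \<open>p\<close> and depths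
  \<open>dep\<close>. The capacities reserve one unit of the degree of each vertex but the root for its parent.\<close>

definition parent_code :: "nat \<Rightarrow> nat \<Rightarrow> nat \<Rightarrow> (nat \<Rightarrow> nat) \<Rightarrow> (nat \<Rightarrow> nat) \<Rightarrow> bool" where
  "parent_code d C N p dep \<longleftrightarrow> 0 < N \<and> dep 0 = 0 \<and>
     (\<forall>s. 0 < s \<and> s < N \<longrightarrow> p s < s \<and> dep s = Suc (dep (p s))) \<and>
     (\<forall>s<N. dep s \<le> d) \<and> (\<forall>i<N. kids N p i \<le> capacity C i)"

context
  fixes d C N p dep
  assumes code: "parent_code d C N p dep"
begin

definition code_edges :: "nat set set" where
  "code_edges = {{p s, s} | s. 0 < s \<and> s < N}"

lemma code_parent: "0 < s \<Longrightarrow> s < N \<Longrightarrow> p s < s" "0 < s \<Longrightarrow> s < N \<Longrightarrow> dep s = Suc (dep (p s))"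
  using code by (auto simp: parent_code_def)

lemma code_adj: "(u, v) \<in> adj code_edges \<longleftrightarrow> (0 < v \<and> v < N \<and> u = p v) \<or> (0 < u \<and> u < N \<and> v = p u)"
  by (auto simp: adj_def code_edges_def doubleton_eq_iff)

lemma code_adj_sym: "(u, v) \<in> adj code_edges \<Longrightarrow> (v, u) \<in> adj code_edges"
  by (auto simp: code_adj)

lemma code_adj_smaller: "(u, v) \<in> adj code_edges \<Longrightarrow> v < u \<Longrightarrow> v = p u"
  using code_parent(1) by (auto simp: code_adj) (metis less_asym)

lemma code_reach: "v < N \<Longrightarrow> (0, v) \<in> adj code_edges ^^ dep v"
proof (induction v rule: less_induct)
  case (less v)
  show ?case
  proof (cases "v = 0")
    case True
    then show ?thesis using code by (simp add: parent_code_def)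
  next
    case False
    then have "(0, p v) \<in> adj code_edges ^^ dep (p v)" "(p v, v) \<in> adj code_edges"
      using less code_parent(1)[of v] by (auto simp: code_adj)
    then show ?thesis using code_parent(2)[of v] False less.prems by auto
  qed
qed

lemma code_depth: "v < N \<Longrightarrow> depth_in code_edges 0 v = dep v"
proof -
  assume v: "v < N"
  have "dep w \<le> m" if "(0, w) \<in> adj code_edges ^^ m" for m w
    using that
  proof (induction m arbitrary: w)
    case 0
    then show ?case using code by (simp add: parent_code_def)
  next
    case (Suc m)
    then obtain u where "dep u \<le> m" "(u, w) \<in> adj code_edges" by auto
    then show ?case using code_parent(2) by (fastforce simp: code_adj)
  qed
  then show ?thesis unfolding depth_in_def using code_reach[OF v] by (intro Least_equality) auto
qed

text \<open>The largest vertex of a cycle would have two distinct smaller neighbours, but its only smaller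
  neighbour is its parent.\<close>

lemma code_acyclic: "\<not> graph_cycle code_edges l"
proof
  assume cyc: "graph_cycle code_edges l"
  define n where "n = length l"
  have n: "n \<ge> 3" and dist: "distinct l"
    and edge: "\<And>i. i < n \<Longrightarrow> (l ! i, l ! (Suc i mod n)) \<in> adj code_edges"
    using cyc by (auto simp: graph_cycle_def n_def)
  have "Max (set l) \<in> set l" using n by (intro Max_in) (auto simp: n_def)
  then obtain i where i: "i < n" "l ! i = Max (set l)" by (auto simp: in_set_conv_nth n_def)
  define i1 where "i1 = Suc i mod n"
  define i2 where "i2 = (if i = 0 then n - 1 else i - 1)"
  have i1: "i1 < n" "i1 \<noteq> i" and i2: "i2 < n" "i2 \<noteq> i" "Suc i2 mod n = i" and ne: "i1 \<noteq> i2"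
    using n i(1) by (auto simp: i1_def i2_def mod_Suc)
  have smaller: "l ! j < l ! i" if "j < n" "j \<noteq> i" for j
  proof -
    have "l ! j \<le> l ! i" using that i by (auto simp: n_def)
    moreover have "l ! j \<noteq> l ! i" using that i(1) dist by (auto simp: n_def nth_eq_iff_index_eq)
    ultimately show ?thesis by simp
  qed
  have "l ! i1 = p (l ! i)"
    using edge[OF i(1)] smaller[OF i1] unfolding i1_def by (rule code_adj_smaller)
  moreover have "l ! i2 = p (l ! i)"
    using code_adj_sym[OF edge[OF i2(1)]] smaller[OF i2(1,2)] unfolding i2(3) by (rule code_adj_smaller)
  ultimately have "l ! i1 = l ! i2" by simp
  then show False
    using nth_eq_iff_index_eq[OF dist, of i1 i2] ne i1(1) i2(1) by (simp add: n_def)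
qed

lemma code_degree:
  assumes "v < N"
  shows "degree_in code_edges v \<le> 2 ^ (C + v)"
proof -
  let ?K = "{s. 0 < s \<and> s < N \<and> p s = v}"
  have fin: "finite ?K" by (rule finite_subset[of _ "{..<N}"]) auto
  have cap: "card ?K \<le> capacity C v" using code assms by (auto simp: parent_code_def kids_def)
  have sub: "{e \<in> code_edges. v \<in> e} \<subseteq> (\<lambda>s. {p s, s}) ` ?K \<union> (if v = 0 then {} else {{p v, v}})"
    by (auto simp: code_edges_def)
  have "degree_in code_edges v \<le> card ((\<lambda>s. {p s, s}) ` ?K \<union> (if v = 0 then {} else {{p v, v}}))"
    unfolding degree_in_def using fin by (intro card_mono sub) auto
  also have "\<dots> \<le> card ((\<lambda>s. {p s, s}) ` ?K) + card (if v = 0 then {} else {{p v, v}})"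
    by (rule card_Un_le)
  also have "\<dots> \<le> capacity C v + (if v = 0 then 0 else 1)"
    using card_image_le[OF fin, of "\<lambda>s. {p s, s}"] cap by auto
  also have "\<dots> \<le> 2 ^ (C + v)" by (auto simp: capacity_def)
  finally show ?thesis .
qed

lemma code_layered_tree: "layered_tree d C {..<N} code_edges 0 [0..<N]"
  unfolding layered_tree_def finite_tree_def
proof (intro conjI ballI allI impI notI)
  show "uniform_hypergraph 2 {..<N} code_edges"
    unfolding uniform_hypergraph_def
  proof (intro conjI ballI)
    fix e assume "e \<in> code_edges"
    then obtain s where s: "e = {p s, s}" "0 < s" "s < N" by (auto simp: code_edges_def)
    then have "p s < s" using code_parent(1) by blast
    then show "e \<subseteq> {..<N}" "card e = 2" using s by auto
  qed simp
  have N: "0 < N" using code by (simp add: parent_code_def)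
  then show "0 \<in> {..<N}" "{..<N} = {} \<Longrightarrow> False" "[0..<N] ! 0 = 0" by auto
  fix u v assume "u \<in> {..<N}" "v \<in> {..<N}"
  then have "(0, u) \<in> (adj code_edges)\<^sup>*" "(0, v) \<in> (adj code_edges)\<^sup>*"
    using code_reach relpow_imp_rtrancl by (metis lessThan_iff)+
  moreover have "sym (adj code_edges)" using code_adj_sym by (auto simp: sym_def)
  ultimately show "(u, v) \<in> (adj code_edges)\<^sup>*" by (meson rtrancl_trans sym_rtrancl symD)
next
  show "\<exists>l. graph_cycle code_edges l \<Longrightarrow> False" using code_acyclic by blast
next
  fix v assume "v \<in> {..<N}"
  then show "depth_in code_edges 0 v \<le> d" using code by (simp add: code_depth parent_code_def)
next
  fix i u assume i: "i < length [0..<N]" "0 < i" "parent_of code_edges 0 u ([0..<N] ! i)"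
  then have pu: "(u, i) \<in> adj code_edges" "depth_in code_edges 0 i = Suc (depth_in code_edges 0 u)"
    by (auto simp: parent_of_def)
  have "u = p i"
  proof (rule ccontr)
    assume "u \<noteq> p i"
    then have "0 < u" "u < N" "i = p u" using pu(1) by (auto simp: code_adj)
    then show False using pu(2) code_parent(2)[of u] i(1) by (simp add: code_depth)
  qed
  then show "\<exists>j<i. [0..<N] ! j = u" using code_parent(1)[of i] i by (intro exI[of _ u]) auto
qed (use code_degree in auto)

end

primrec tree_growth :: "nat \<Rightarrow> nat \<Rightarrow> nat \<Rightarrow> nat" where
  "tree_growth C 0 = Suc"
| "tree_growth C (Suc h) = (\<lambda>a. (tree_growth C h ^^ (2 ^ (C + a) - 1)) (Suc a))"

lemma tree_growth_mono_le: "mono (tree_growth C h) \<and> (\<forall>a. a \<le> tree_growth C h a)"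
proof (induction h)
  case (Suc h)
  then have le: "\<And>a. a \<le> tree_growth C h a" by blast
  have "mono (tree_growth C (Suc h))"
    using Suc le by (auto intro!: monoI funpow_le_funpow diff_le_mono power_increasing)
  moreover have "a \<le> tree_growth C (Suc h) a" for a
    using le_funpow[OF le, of "Suc a"] Suc_leD by fastforce
  ultimately show ?case by blast
qed (auto simp: mono_Suc)

lemmas tree_growth_mono = tree_growth_mono_le[THEN conjunct1]
lemmas le_tree_growth = tree_growth_mono_le[THEN conjunct2, rule_format]

text \<open>An extension of a coded tree in which the only old vertex with new children is \<open>q\<close>, which gets \<open>j\<close>
  of them.\<close>

definition grows :: "nat \<Rightarrow> nat \<Rightarrow> nat \<Rightarrow> nat \<Rightarrow> nat \<Rightarrow> (nat \<Rightarrow> nat) \<Rightarrow> (nat \<Rightarrow> nat) \<Rightarrow>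
    nat \<Rightarrow> (nat \<Rightarrow> nat) \<Rightarrow> (nat \<Rightarrow> nat) \<Rightarrow> bool" where
  "grows d C q j N p dep N' p' dep' \<longleftrightarrow> parent_code d C N' p' dep' \<and> N \<le> N' \<and>
     (\<forall>s<N. p' s = p s \<and> dep' s = dep s) \<and>
     (\<forall>i<N. kids N' p' i = kids N p i + (if i = q then j else 0))"

lemma grow_vertex:
  assumes code: "parent_code d C N p dep" and q: "q < N" "Suc (dep q) \<le> d" "kids N p q < capacity C q"
  defines "p' \<equiv> p(N := q)" and "dep' \<equiv> dep(N := Suc (dep q))"
  shows "grows d C q 1 N p dep (Suc N) p' dep'" and "kids (Suc N) p' N = 0"
proof -
  have fin: "finite {s. 0 < s \<and> s < N \<and> p s = i}" for i
    by (rule finite_subset[of _ "{..<N}"]) auto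
  have N: "0 < N" and par: "\<And>s. 0 < s \<Longrightarrow> s < N \<Longrightarrow> p s < s \<and> dep s = Suc (dep (p s))"
    using code by (auto simp: parent_code_def)
  have kids: "kids (Suc N) p' i = kids N p i + (if i = q then 1 else 0)" for i
  proof -
    have "{s. 0 < s \<and> s < Suc N \<and> p' s = i} =
        {s. 0 < s \<and> s < N \<and> p s = i} \<union> (if i = q then {N} else {})"
      using N by (auto simp: p'_def less_Suc_eq)
    then show ?thesis using fin by (simp add: kids_def)
  qed
  have "kids N p N = 0"
  proof -
    have "p s \<noteq> N" if "0 < s" "s < N" for s using par[OF that] that by linarith
    then have "{s. 0 < s \<and> s < N \<and> p s = N} = {}" by blast
    then show ?thesis by (simp only: kids_def card.empty)
  qed
  then show "kids (Suc N) p' N = 0" using kids[of N] q(1) by simp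
  have "parent_code d C (Suc N) p' dep'"
    unfolding parent_code_def
  proof (intro conjI allI impI)
    show "dep' 0 = 0" using code N by (simp add: parent_code_def dep'_def)
    fix s assume s: "0 < s \<and> s < Suc N"
    then show "p' s < s" using par q by (auto simp: p'_def less_Suc_eq)
    show "dep' s = Suc (dep' (p' s))"
    proof (cases "s = N")
      case False
      then have "p s < s" "s < N" "dep s = Suc (dep (p s))" using par s by auto
      then show ?thesis by (simp add: p'_def dep'_def)
    qed (use q in \<open>simp add: p'_def dep'_def\<close>)
  next
    fix s assume "s < Suc N"
    then show "dep' s \<le> d" using code q by (auto simp: parent_code_def dep'_def less_Suc_eq)
  next
    fix i assume "i < Suc N"
    then show "kids (Suc N) p' i \<le> capacity C i"
      using code q kids[of i] \<open>kids N p N = 0\<close> by (auto simp: parent_code_def less_Suc_eq)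
  qed simp
  then show "grows d C q 1 N p dep (Suc N) p' dep'"
    using kids by (auto simp: grows_def p'_def dep'_def)
qed

text \<open>To add a subtree of height \<open>Suc h\<close>, append a vertex and exhaust its capacity with subtrees
  of height \<open>h\<close>, one after the other. Each of them starts at a later position than its predecessor
  and hence has a larger capacity; this iteration is the recursion of \<open>tree_growth\<close>.\<close>

lemma grow_subtrees:
  assumes "parent_code d C N p dep" "q < N" "dep q + Suc h \<le> d" "kids N p q + j \<le> capacity C q"
  shows "\<exists>N' p' dep'. grows d C q j N p dep N' p' dep' \<and> (tree_growth C h ^^ j) N \<le> N'"
  using assms
proof (induction h arbitrary: N p dep q j)
  fix N p dep q j and h :: nat
  \<comment> \<open>One subtree of height at most \<open>h\<close> suffices, because subtrees can be added one after another.\<close>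
  have iterate: "\<exists>N' p' dep'. grows d C q j N p dep N' p' dep' \<and> (tree_growth C h ^^ j) N \<le> N'"
    if one: "\<And>N p dep. parent_code d C N p dep \<Longrightarrow> q < N \<Longrightarrow> dep q + Suc h \<le> d \<Longrightarrow>
        kids N p q < capacity C q \<Longrightarrow>
        \<exists>N' p' dep'. grows d C q 1 N p dep N' p' dep' \<and> tree_growth C h N \<le> N'"
      and "parent_code d C N p dep" "q < N" "dep q + Suc h \<le> d" "kids N p q + j \<le> capacity C q"
    for N p dep q j and h :: nat
    using that(2-)
  proof (induction j arbitrary: N p dep)
    case 0
    then show ?case by (intro exI[of _ N] exI[of _ p] exI[of _ dep]) (auto simp: grows_def)
  next
    case (Suc j)
    obtain N1 p1 dep1 where 1: "grows d C q 1 N p dep N1 p1 dep1" "tree_growth C h N \<le> N1"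
      using one[of N p dep] Suc.prems by auto
    then have q: "parent_code d C N1 p1 dep1" "q < N1" "dep1 q + Suc h \<le> d"
      "kids N1 p1 q + j \<le> capacity C q"
      using Suc.prems by (auto simp: grows_def)
    then obtain N2 p2 dep2 where 2: "grows d C q j N1 p1 dep1 N2 p2 dep2" "(tree_growth C h ^^ j) N1 \<le> N2"
      using Suc.IH by blast
    have "grows d C q (Suc j) N p dep N2 p2 dep2" using 1 2 by (auto simp: grows_def)
    moreover have "(tree_growth C h ^^ Suc j) N \<le> (tree_growth C h ^^ j) N1"
      unfolding funpow_Suc_right o_def by (rule funpow_mono[OF tree_growth_mono 1(2)])
    ultimately show ?case using 2(2) order_trans by blast
  qed
  {
    case 0
    show ?case
    proof (rule iterate[OF _ 0])
      fix N p dep assume *: "parent_code d C N p dep" "q < N" "dep q + Suc 0 \<le> d" "kids N p q < capacity C q"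
      then show "\<exists>N' p' dep'. grows d C q 1 N p dep N' p' dep' \<and> tree_growth C 0 N \<le> N'"
        using grow_vertex(1)[OF *(1,2) _ *(4)] by auto
    qed
  next
    case (Suc h)
    show ?case
    proof (rule iterate[OF _ Suc(2-)])
      fix N p dep
      assume *: "parent_code d C N p dep" "q < N" "dep q + Suc (Suc h) \<le> d" "kids N p q < capacity C q"
      define p1 where "p1 = p(N := q)"
      define dep1 where "dep1 = dep(N := Suc (dep q))"
      have 1: "grows d C q 1 N p dep (Suc N) p1 dep1" "kids (Suc N) p1 N = 0"
        using grow_vertex[OF *(1,2) _ *(4)] *(3) by (simp_all add: p1_def dep1_def)
      obtain N2 p2 dep2 where 2: "grows d C N (capacity C N) (Suc N) p1 dep1 N2 p2 dep2"
        "(tree_growth C h ^^ capacity C N) (Suc N) \<le> N2"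
      proof -
        have "parent_code d C (Suc N) p1 dep1" using 1(1) by (simp add: grows_def)
        moreover have "dep1 N + Suc h \<le> d" using *(3) by (simp add: dep1_def)
        moreover have "kids (Suc N) p1 N + capacity C N \<le> capacity C N" using 1(2) by simp
        ultimately show thesis using Suc(1) that by blast
      qed
      have "grows d C q 1 N p dep N2 p2 dep2" using 1 2 by (auto simp: grows_def)
      moreover have "tree_growth C (Suc h) N \<le> N2"
        using 2(2) * by (simp add: capacity_def)
      ultimately show "\<exists>N' p' dep'. grows d C q 1 N p dep N' p' dep' \<and> tree_growth C (Suc h) N \<le> N'"
        by blast
    qed
  }
qed

lemma funpow_le_funpow_pointwise:
  fixes f g :: "nat \<Rightarrow> nat"
  assumes "mono g" "\<And>y. y \<le> f y" "\<And>y. 1 \<le> y \<Longrightarrow> g y \<le> f y" "1 \<le> x"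
  shows "(g ^^ t) x \<le> (f ^^ t) x"
proof (induction t)
  case (Suc t)
  have "x \<le> (f ^^ t) x" by (rule le_funpow[OF assms(2)])
  then have "g ((f ^^ t) x) \<le> f ((f ^^ t) x)" using assms(3,4) by simp
  then show ?case using monoD[OF assms(1) Suc] by simp
qed simp

lemma slow_le_tree_growth: "1 \<le> a \<Longrightarrow> slow i a \<le> tree_growth C (Suc i) a"
proof (induction i arbitrary: a)
  case 0
  have "(2::nat) ^ a \<le> 2 ^ (C + a)" by (rule power_increasing) auto
  moreover have "(Suc ^^ t) b = t + b" for t b by (induction t) auto
  ultimately show ?case using trans_le_add1[of "2 ^ a" "2 ^ (C + a)" a] by simp
next
  case (Suc i)
  have "a \<le> 2 ^ (C + a) - 1"
    using Suc_le_two_pow[of a] power_increasing[of a "C + a" "2::nat"] by linarith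
  then have "(slow i ^^ a) 1 \<le> (tree_growth C (Suc i) ^^ (2 ^ (C + a) - 1)) (Suc a)"
    using funpow_le_funpow_pointwise[OF slow_mono le_tree_growth Suc.IH, of 1 a]
      funpow_le_funpow[OF tree_growth_mono le_tree_growth, of a _ 1 "Suc a" C "Suc i"] order_trans
    by fastforce
  then show ?case by simp
qed

lemma slow_le_N0:
  assumes "d \<ge> 2"
  shows "(slow (d - 2) ^^ 2 ^ C) 1 \<le> N0 d C"
proof -
  have "{s. 0 < s \<and> s < (1::nat) \<and> p s = i} = {}" for p :: "nat \<Rightarrow> nat" and i by auto
  then have kids: "kids 1 p i = 0" for p i by (simp only: kids_def card.empty)
  then have "parent_code d C 1 (\<lambda>_. 0) (\<lambda>_. 0)" by (auto simp: parent_code_def)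
  moreover have "kids 1 (\<lambda>_. 0) 0 + 2 ^ C \<le> capacity C 0" unfolding kids by (simp add: capacity_def)
  ultimately obtain N p dep where *: "grows d C 0 (2 ^ C) 1 (\<lambda>_. 0) (\<lambda>_. 0) N p dep"
    "(tree_growth C (d - 1) ^^ 2 ^ C) 1 \<le> N"
    using grow_subtrees[of d C 1 "\<lambda>_. 0" "\<lambda>_. 0" 0 "d - 1" "2 ^ C"] assms by auto
  have "(slow (d - 2) ^^ 2 ^ C) 1 \<le> (tree_growth C (Suc (d - 2)) ^^ 2 ^ C) 1"
    by (rule funpow_le_funpow_pointwise[OF slow_mono le_tree_growth slow_le_tree_growth]) auto
  also have "Suc (d - 2) = d - 1" using assms by simp
  also have "(tree_growth C (d - 1) ^^ 2 ^ C) 1 \<le> card {..<N}" using *(2) by simp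
  also have "\<dots> \<le> N0 d C"
    using *(1) by (intro card_le_N0[OF assms code_layered_tree[of d C N p dep]]) (simp add: grows_def)
  finally show ?thesis .
qed

section \<open>Many clique sizes force many missing sizes\<close>

text \<open>Fix one maximal clique \<open>X l\<close> for each occurring number \<open>l\<close> of missed vertices. These numbers, the
  losses, play the role of time. Large cliques come first, so the early cliques miss few
  vertices altogether.\<close>

context
  fixes k :: nat and V :: "'a set" and E and X :: "nat \<Rightarrow> 'a set" and \<Lambda> :: "nat set"
  assumes hyp: "uniform_hypergraph k V E"
    and maxc: "\<And>l. l \<in> \<Lambda> \<Longrightarrow> maximal_clique k V E (X l)"
    and loss: "\<And>l. l \<in> \<Lambda> \<Longrightarrow> card (V - X l) = l"
begin

definition outside :: "nat \<Rightarrow> 'a set" where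
  "outside a = (\<Union>l\<in>{l \<in> \<Lambda>. l \<le> a}. V - X l)"

text \<open>This describes an increasing chain of times that ends in \<open>a\<close>: at each step from \<open>a'\<close> to \<open>a\<close>, all parts
  of one size of the trace of \<open>X l\<close> on \<open>outside a'\<close> lie in cliques of loss at most \<open>a\<close>, and this size
  runs through \<open>1, \<dots>, j\<close> along the chain. The base case only makes sure that some clique has loss at
  most \<open>a\<close>.\<close>

primrec covered :: "nat \<Rightarrow> nat \<Rightarrow> nat \<Rightarrow> bool" where
  "covered 0 a l \<longleftrightarrow> a \<in> \<Lambda>"
| "covered (Suc j) a l \<longleftrightarrow> (\<exists>a'\<le>a. covered j a' l \<and>
     (\<forall>S. S \<subseteq> X l \<inter> outside a' \<and> card S = Suc j \<longrightarrow> (\<exists>l'\<in>\<Lambda>. l' \<le> a \<and> S \<subseteq> X l')))"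

lemma finite_V: "finite V"
  using hyp by (simp add: uniform_hypergraph_def)

lemma X_subset: "l \<in> \<Lambda> \<Longrightarrow> X l \<subseteq> V"
  using maxc by (auto simp: maximal_clique_def complete_set_def)

lemma X_edge: "l \<in> \<Lambda> \<Longrightarrow> Y \<subseteq> X l \<Longrightarrow> card Y = k \<Longrightarrow> Y \<in> E"
  using maxc by (auto simp: maximal_clique_def complete_set_def)

lemma X_inj: "inj_on X \<Lambda>"
  using loss by (metis inj_onI)

lemma outside_mono: "a \<le> b \<Longrightarrow> outside a \<subseteq> outside b"
  by (auto simp: outside_def)

lemma outside_subset: "outside a \<subseteq> V"
  by (auto simp: outside_def)

lemma finite_outside: "finite (outside a)"
  using outside_subset finite_V finite_subset by blast

lemma notin_outside: "x \<in> V \<Longrightarrow> x \<notin> outside a \<Longrightarrow> l \<in> \<Lambda> \<Longrightarrow> l \<le> a \<Longrightarrow> x \<in> X l"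
  by (auto simp: outside_def)

lemma card_outside: "card (outside a) \<le> a * a + a"
proof -
  let ?I = "{l \<in> \<Lambda>. l \<le> a}"
  have fin: "finite ?I" by (rule finite_subset[of _ "{..a}"]) auto
  have "card (outside a) \<le> (\<Sum>l\<in>?I. card (V - X l))"
    unfolding outside_def by (rule card_UN_le[OF fin])
  also have "\<dots> \<le> (\<Sum>l\<in>?I. a)" by (rule sum_mono) (simp add: loss)
  also have "\<dots> \<le> (\<Sum>l\<in>{..a}. a)" by (rule sum_mono2) auto
  finally show ?thesis by simp
qed

text \<open>Going down the chain, the intersections of \<open>e\<close> with the sets \<open>outside a'\<close> shrink while the allowed
  sizes decrease by one. At some level the intersection has not changed from the one before and
  has exactly the size for which parts of the trace are known to lie in an early clique. That clique
  contains the rest of \<open>e\<close> as well, because no early clique misses a vertex that is not outside. At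
  the start of the chain the allowed size is \<open>0\<close>, and every early clique contains all of \<open>e\<close>.\<close>

lemma covered_edge:
  assumes "covered j a l" "finite e" "e \<subseteq> V" "card (e \<inter> outside a) \<le> j" "e \<inter> outside a \<subseteq> X l"
  shows "\<exists>l'\<in>\<Lambda>. e \<subseteq> X l'"
proof -
  have "\<exists>l'\<in>\<Lambda>. l' \<le> a \<and> e \<subseteq> X l'"
    using assms
  proof (induction j arbitrary: a)
    case 0
    then have "e \<inter> outside a = {}" by simp
    then show ?case using notin_outside[of _ a a] 0 by auto
  next
    case (Suc j)
    then obtain a' where a': "a' \<le> a" "covered j a' l"
      "\<And>S. S \<subseteq> X l \<inter> outside a' \<Longrightarrow> card S = Suc j \<Longrightarrow> \<exists>l'\<in>\<Lambda>. l' \<le> a \<and> S \<subseteq> X l'"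
      by auto
    have sub: "e \<inter> outside a' \<subseteq> e \<inter> outside a" using outside_mono[OF a'(1)] by auto
    show ?case
    proof (cases "card (e \<inter> outside a') \<le> j")
      case True
      then have "\<exists>l'\<in>\<Lambda>. l' \<le> a' \<and> e \<subseteq> X l'"
        using Suc.IH[OF a'(2)] Suc.prems sub by blast
      then show ?thesis using a'(1) by (meson order_trans)
    next
      case False
      have eq: "e \<inter> outside a' = e \<inter> outside a"
        using False Suc.prems by (intro card_seteq sub) auto
      then have "card (e \<inter> outside a') = Suc j" using False Suc.prems by simp
      then obtain l' where l': "l' \<in> \<Lambda>" "l' \<le> a" "e \<inter> outside a' \<subseteq> X l'"
        using a'(3)[of "e \<inter> outside a'"] Suc.prems eq by auto
      then have "e \<subseteq> X l'" using notin_outside[of _ a l'] Suc.prems(3) eq by blast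
      then show ?thesis using l' by blast
    qed
  qed
  then show ?thesis by blast
qed

text \<open>A \<open>k\<close>-set \<open>Y\<close> in the union of the two cliques is an edge: if at least \<open>k - 1\<close> of its vertices are
  outside, these belong to both cliques and the last vertex decides for one of them; otherwise \<open>Y\<close>
  lies in some clique by the previous lemma. So the union is complete, and maximality identifies
  the two cliques.\<close>

lemma covered_determines:
  assumes "k \<ge> 2" "covered (k - 2) a l" "l \<in> \<Lambda>" "l' \<in> \<Lambda>" "X l \<inter> outside a = X l' \<inter> outside a"
  shows "l = l'"
proof -
  have "complete_set k V E (X l \<union> X l')"
    unfolding complete_set_def
  proof (intro conjI allI impI)
    show "X l \<union> X l' \<subseteq> V" using X_subset assms by auto
    fix Y assume Y: "Y \<subseteq> X l \<union> X l' \<and> card Y = k"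
    then have fin: "finite Y" using assms(1) card.infinite by fastforce
    have both: "Y \<inter> outside a \<subseteq> X l" "Y \<inter> outside a \<subseteq> X l'" using Y assms(5) by auto
    show "Y \<in> E"
    proof (cases "card (Y \<inter> outside a) \<le> k - 2")
      case True
      then obtain l'' where "l'' \<in> \<Lambda>" "Y \<subseteq> X l''"
        using covered_edge[OF assms(2) fin _ True both(1)] Y X_subset assms by blast
      then show ?thesis using X_edge Y by blast
    next
      case False
      have "card Y = card (Y \<inter> outside a) + card (Y - outside a)"
        using fin by (simp add: card_Int_Diff)
      then have "card (Y - outside a) \<le> Suc 0" using False Y by simp
      then have "\<forall>x\<in>Y - outside a. \<forall>y\<in>Y - outside a. x = y"
        using fin by (subst (asm) card_le_Suc0_iff_eq) auto
      then have single: "x = y" if "x \<in> Y - outside a" "y \<in> Y - outside a" for x y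
        using that by blast
      have "Y - outside a \<subseteq> X l'" if "x \<in> Y - outside a" "x \<notin> X l" for x
      proof
        fix y assume "y \<in> Y - outside a"
        then have "y = x" using single that(1) by blast
        then show "y \<in> X l'" using that Y by blast
      qed
      then have "Y - outside a \<subseteq> X l \<or> Y - outside a \<subseteq> X l'" by blast
      then have "Y \<subseteq> X l \<or> Y \<subseteq> X l'" using both by blast
      then show ?thesis using X_edge assms(3,4) Y by blast
    qed
  qed
  then have "X l \<union> X l' = X l" "X l \<union> X l' = X l'"
    using maxc[OF assms(3)] maxc[OF assms(4)] unfolding maximal_clique_def
    by (meson Un_upper1, meson Un_upper2)
  then show ?thesis using X_inj assms(3,4) by (metis inj_onD)
qed

definition covered_between :: "nat \<Rightarrow> nat \<Rightarrow> nat \<Rightarrow> bool" where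
  "covered_between j a b \<longleftrightarrow>
     b \<le> card V \<and> (\<forall>l\<in>\<Lambda>. a < l \<and> l < b \<longrightarrow> covered j a l)"

lemma few_covered:
  assumes "k \<ge> 2" "covered_between (k - 2) a b"
  shows "card (\<Lambda> \<inter> {a<..<b}) \<le> 2 ^ card (outside a)"
proof -
  have "card (\<Lambda> \<inter> {a<..<b}) \<le> card (Pow (outside a))"
  proof (rule card_inj_on_le[where f = "\<lambda>l. X l \<inter> outside a"])
    show "inj_on (\<lambda>l. X l \<inter> outside a) (\<Lambda> \<inter> {a<..<b})"
      using covered_determines[OF assms(1)] assms(2) by (intro inj_onI) (auto simp: covered_between_def)
  qed (auto simp: finite_outside)
  then show ?thesis by (simp add: card_Pow finite_outside)
qed

text \<open>The epoch is broken at each clique whose trace contains a \<open>Suc j\<close>-element set that no clique of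
  smaller loss contains. Different breaks have different new sets, so a binomial coefficient
  bounds their number.\<close>

lemma split_at_new_subset:
  assumes "covered_between j a b"
  shows "\<exists>T. finite T \<and> T \<subseteq> {a<..<b} \<and> card T \<le> card (outside a) choose Suc j \<and>
          (\<forall>t\<in>insert a T. \<forall>b'\<le>b. T \<inter> {t<..<b'} = {} \<longrightarrow> covered_between (Suc j) t b')"
proof -
  define new where "new = (\<lambda>l S. S \<subseteq> X l \<inter> outside a \<and> card S = Suc j \<and>
    (\<forall>l'\<in>\<Lambda>. S \<subseteq> X l' \<longrightarrow> l \<le> l'))"
  define T where "T = {l \<in> \<Lambda>. a < l \<and> l < b \<and> (\<exists>S. new l S)}"
  define f where "f = (\<lambda>l. SOME S. new l S)"
  have f: "new l (f l)" if "l \<in> T" for l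
    using that unfolding T_def f_def by (auto intro: someI)
  have "card T \<le> card {S. S \<subseteq> outside a \<and> card S = Suc j}"
  proof (rule card_inj_on_le)
    show "inj_on f T"
    proof (rule inj_onI)
      fix l l' assume *: "l \<in> T" "l' \<in> T" "f l = f l'"
      then have "f l \<subseteq> X l" "f l \<subseteq> X l'" "l \<in> \<Lambda>" "l' \<in> \<Lambda>"
        using f[OF *(1)] f[OF *(2)] *(3) *(1,2) unfolding new_def T_def by simp_all
      then have "l \<le> l'" "l' \<le> l" using f[OF *(1)] f[OF *(2)] *(3) unfolding new_def by metis+
      then show "l = l'" by simp
    qed
    show "f ` T \<subseteq> {S. S \<subseteq> outside a \<and> card S = Suc j}" using f by (auto simp: new_def)
    show "finite {S. S \<subseteq> outside a \<and> card S = Suc j}"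
      by (rule finite_subset[of _ "Pow (outside a)"]) (auto simp: finite_outside)
  qed
  then have card: "card T \<le> card (outside a) choose Suc j" by (simp add: n_subsets finite_outside)
  have "covered_between (Suc j) t b'" if *: "t \<in> insert a T" "b' \<le> b" "T \<inter> {t<..<b'} = {}" for t b'
    unfolding covered_between_def
  proof (intro conjI ballI impI)
    show "b' \<le> card V" using * assms by (simp add: covered_between_def)
    have at: "a \<le> t" using *(1) by (auto simp: T_def)
    fix l assume l: "l \<in> \<Lambda>" "t < l \<and> l < b'"
    then have "covered j a l" using assms * at by (simp add: covered_between_def)
    moreover have "\<exists>l'\<in>\<Lambda>. l' \<le> t \<and> S \<subseteq> X l'"
      if S: "S \<subseteq> X l \<inter> outside a \<and> card S = Suc j" for S
    proof -
      define l' where "l' = (LEAST l'. l' \<in> \<Lambda> \<and> S \<subseteq> X l')"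
      have l': "l' \<in> \<Lambda> \<and> S \<subseteq> X l'" unfolding l'_def by (rule LeastI[of _ l]) (use S l in auto)
      have least: "l' \<le> l''" if "l'' \<in> \<Lambda>" "S \<subseteq> X l''" for l''
        unfolding l'_def using that by (intro Least_le) simp
      have "l' \<le> l" using least S l by auto
      have "new l' S" using S l' least by (auto simp: new_def)
      have "l' \<le> t"
      proof (rule ccontr)
        assume "\<not> l' \<le> t"
        then have "l' \<in> T" "l' \<in> {t<..<b'}"
          using at \<open>l' \<le> l\<close> l * l' \<open>new l' S\<close> by (auto simp: T_def)
        then show False using *(3) by blast
      qed
      then show ?thesis using l' by blast
    qed
    ultimately show "covered (Suc j) t l" using at by auto
  qed
  moreover have "finite T" by (rule finite_subset[of _ "{..b}"]) (auto simp: T_def)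
  moreover have "T \<subseteq> {a<..<b}" by (auto simp: T_def)
  ultimately show ?thesis using card by blast
qed

text \<open>The first clique misses at most \<open>m\<close> vertices, where \<open>m\<close> counts the losses that do not occur. Hence the
  first split, at the times when a new single vertex outside of it is covered, has at most \<open>m\<close>
  breaks; as for trees, this makes the final bound linear in \<open>m\<close>.\<close>

lemma clique_loss_bound:
  assumes "k \<ge> 3" and "\<Lambda> \<subseteq> {..<card V}" and "\<Lambda> \<noteq> {}"
    and m: "m = card ({..<card V} - \<Lambda>)" and "m \<le> y"
  shows "card V \<le> (fast (k - 3) ^^ Suc m) y"
proof -
  define a0 where "a0 = Min \<Lambda>"
  have fin: "finite \<Lambda>" using assms(2) finite_subset by blast
  have a0: "a0 \<in> \<Lambda>" "\<And>l. l \<in> \<Lambda> \<Longrightarrow> a0 \<le> l" unfolding a0_def using fin assms(3) by auto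
  have "{..<a0} \<subseteq> {..<card V} - \<Lambda>" using a0 assms(2) by force
  then have "card {..<a0} \<le> m" unfolding m by (intro card_mono) auto
  then have a0_m: "a0 \<le> m" by simp
  have "outside a0 = V - X a0"
    using a0 by (force simp: outside_def intro: order_antisym)
  then have out: "card (outside a0) = a0" using loss[OF a0(1)] by simp
  have pow: "2 ^ card (outside a) \<le> (2 :: nat) ^ (y * y + y + 1)" if "a \<le> y" for a y
    using card_outside[of a] that mult_le_mono[of a y a y] by (intro power_increasing) auto
  have start: "covered_between 0 a0 (card V)" using a0 by (auto simp: covered_between_def)
  obtain T where T: "finite T" "T \<subseteq> {a0<..<card V}" "card T \<le> card (outside a0) choose Suc 0"
    "\<forall>t\<in>insert a0 T. \<forall>b'\<le>card V. T \<inter> {t<..<b'} = {} \<longrightarrow> covered_between (Suc 0) t b'"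
    using split_at_new_subset[OF start] by blast
  define P where "P = (\<lambda>i. covered_between (k - 2 - i))"
  have "card V \<le> (fast (k - 3) ^^ Suc (card T)) y"
  proof (rule bound_by_breaks[OF T(1,2) _ assms(5) le_fast])
    fix t b' y assume *: "t \<in> insert a0 T" "b' \<le> card V" "T \<inter> {t<..<b'} = {}" "t \<le> y" "m \<le> y"
    show "b' \<le> fast (k - 3) y"
    proof (rule epoch_bound[where P = P and h = "k - 3"])
      \<comment> \<open>In an epoch of rank \<open>0\<close> the cliques are determined by their traces on a set of bounded size.\<close>
      fix a b y assume P: "P 0 a b" and y: "a \<le> y" "m \<le> y"
      have "{a<..<b} \<subseteq> (\<Lambda> \<inter> {a<..<b}) \<union> ({..<card V} - \<Lambda>)"
        using P by (auto simp: P_def covered_between_def)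
      then have "card {a<..<b} \<le> card ((\<Lambda> \<inter> {a<..<b}) \<union> ({..<card V} - \<Lambda>))"
        by (intro card_mono) auto
      also have "\<dots> \<le> card (\<Lambda> \<inter> {a<..<b}) + m" unfolding m by (rule card_Un_le)
      also have "card (\<Lambda> \<inter> {a<..<b}) \<le> 2 ^ card (outside a)"
        using few_covered[of a b] P assms(1) unfolding P_def diff_zero by linarith
      finally have "b \<le> 2 * y + 1 + 2 ^ (y * y + y + 1)" using pow[OF y(1)] y by simp
      then show "b \<le> tower3 y" using le_tower3_quadratic[of y] by linarith
    next
      fix i a b assume i: "i < k - 3" and P: "P (Suc i) a b"
      have "Suc (k - 2 - Suc i) = k - 2 - i" using i by simp
      then obtain T where "finite T" "T \<subseteq> {a<..<b}"
        and c: "card T \<le> card (outside a) choose (k - 2 - i)"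
        and "\<forall>t\<in>insert a T. \<forall>b'\<le>b. T \<inter> {t<..<b'} = {} \<longrightarrow> P i t b'"
        using split_at_new_subset[OF P[unfolded P_def]] unfolding P_def by metis
      moreover have "card T < tower3 y" if "a \<le> y" for y
        using c binomial_le_pow2[of "card (outside a)" "k - 2 - i"] pow[OF that]
          le_tower3_quadratic[of y] by linarith
      ultimately show "\<exists>T. finite T \<and> T \<subseteq> {a<..<b} \<and> (\<forall>y. a \<le> y \<longrightarrow> m \<le> y \<longrightarrow> card T < tower3 y)
          \<and> (\<forall>t\<in>insert a T. \<forall>b'\<le>b. T \<inter> {t<..<b'} = {} \<longrightarrow> P i t b')" by blast
    next
      have "k - 2 - (k - 3) = Suc 0" using assms(1) by simp
      then show "P (k - 3) t b'" unfolding P_def using T(4) *(1-3) by metis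
    qed (use * in auto)
  qed (use a0_m assms in simp)
  also have "\<dots> \<le> (fast (k - 3) ^^ Suc m) y"
    using T(3) a0_m out by (intro funpow_le_funpow fast_mono le_fast) auto
  finally show ?thesis .
qed

end

lemma clique_sizes_subset:
  assumes "uniform_hypergraph k V E"
  shows "clique_sizes k V E \<subseteq> {..card V}"
  using assms card_mono
  by (fastforce simp: clique_sizes_def maximal_clique_def complete_set_def uniform_hypergraph_def)

lemma clique_sizes_pos:
  assumes "uniform_hypergraph k V E" "k \<ge> 2" "V \<noteq> {}"
  shows "0 \<notin> clique_sizes k V E"
proof
  assume "0 \<in> clique_sizes k V E"
  then obtain X where X: "maximal_clique k V E X" "card X = 0" by (auto simp: clique_sizes_def)
  then have "X \<subseteq> V" "finite V"
    using assms by (auto simp: maximal_clique_def complete_set_def uniform_hypergraph_def)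
  then have "X = {}" using X(2) finite_subset by fastforce
  obtain v where "v \<in> V" using assms(3) by blast
  have "complete_set k V E {v}"
    unfolding complete_set_def
  proof (intro conjI allI impI)
    fix Y assume "Y \<subseteq> {v} \<and> card Y = k"
    then have "k \<le> 1" using card_mono[of "{v}" Y] by auto
    then show "Y \<in> E" using assms(2) by simp
  qed (use \<open>v \<in> V\<close> in simp)
  then show False using X(1) \<open>X = {}\<close> by (auto simp: maximal_clique_def)
qed

lemma clique_sizes_bound:
  assumes hyp: "uniform_hypergraph k V E" and "k \<ge> 3" "V \<noteq> {}"
    and m: "card V = m + card (clique_sizes k V E)" and "m \<le> y"
  shows "card V \<le> (fast (k - 3) ^^ Suc m) y"
proof (cases "clique_sizes k V E = {}")
  case True
  then have "card V \<le> y" using m assms(5) by simp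
  also have "\<dots> \<le> (fast (k - 3) ^^ Suc m) y" by (rule le_funpow[OF le_fast])
  finally show ?thesis .
next
  case False
  define S where "S = clique_sizes k V E"
  define \<Lambda> where "\<Lambda> = (\<lambda>s. card V - s) ` S"
  have fin: "finite V" using hyp by (simp add: uniform_hypergraph_def)
  have S: "S \<subseteq> {1..card V}"
    using clique_sizes_subset[OF hyp] clique_sizes_pos[OF hyp] assms(2,3)
    by (auto simp: S_def Suc_le_eq intro: gr0I)
  have "\<forall>l\<in>\<Lambda>. \<exists>X. maximal_clique k V E X \<and> card (V - X) = l"
  proof
    fix l assume "l \<in> \<Lambda>"
    then obtain X where X: "maximal_clique k V E X" "l = card V - card X"
      by (auto simp: \<Lambda>_def S_def clique_sizes_def)
    then have "X \<subseteq> V" by (auto simp: maximal_clique_def complete_set_def)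
    then show "\<exists>X. maximal_clique k V E X \<and> card (V - X) = l"
      using X finite_subset[OF _ fin] by (intro exI[of _ X]) (simp add: card_Diff_subset)
  qed
  then obtain X where X: "\<And>l. l \<in> \<Lambda> \<Longrightarrow> maximal_clique k V E (X l)"
    "\<And>l. l \<in> \<Lambda> \<Longrightarrow> card (V - X l) = l" by metis
  have \<Lambda>: "\<Lambda> \<subseteq> {..<card V}" using S by (auto simp: \<Lambda>_def)
  have "card \<Lambda> = card S"
    unfolding \<Lambda>_def
  proof (intro card_image inj_onI)
    fix s t assume "s \<in> S" "t \<in> S" "card V - s = card V - t"
    moreover have "s \<le> card V" "t \<le> card V" using S calculation by auto
    ultimately show "s = t" by linarith
  qed
  then have "m = card ({..<card V} - \<Lambda>)"
    using m \<Lambda> by (simp add: card_Diff_subset finite_subset S_def)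
  moreover have "\<Lambda> \<noteq> {}" using False by (simp add: \<Lambda>_def S_def)
  ultimately show ?thesis using clique_loss_bound[OF hyp X assms(2) \<Lambda> _ _ assms(5)] by blast
qed

lemma g_num_attained:
  shows "\<exists>(V :: nat set) E. uniform_hypergraph k V E \<and> card V = n \<and> card (clique_sizes k V E) = g_num n k"
    and "uniform_hypergraph k V E \<Longrightarrow> card (V :: nat set) = n \<Longrightarrow> card (clique_sizes k V E) \<le> g_num n k"
proof -
  let ?S = "{card (clique_sizes k V E) | (V :: nat set) E. uniform_hypergraph k V E \<and> card V = n}"
  have "?S \<subseteq> {..Suc n}"
  proof
    fix s assume "s \<in> ?S"
    then obtain V :: "nat set" and E where VE: "uniform_hypergraph k V E" "card V = n"
      "s = card (clique_sizes k V E)" by blast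
    then have "s \<le> card {..n}"
      using clique_sizes_subset[OF VE(1)] by (auto intro!: card_mono simp del: card_atMost)
    then show "s \<in> {..Suc n}" by simp
  qed
  then have fin: "finite ?S" using finite_subset by blast
  have "uniform_hypergraph k {..<n} {}" by (simp add: uniform_hypergraph_def)
  then have "card (clique_sizes k {..<n} {}) \<in> ?S" by (metis (mono_tags, lifting) card_lessThan mem_Collect_eq)
  then have "Max ?S \<in> ?S" by (intro Max_in[OF fin]) blast
  then show "\<exists>(V :: nat set) E. uniform_hypergraph k V E \<and> card V = n \<and> card (clique_sizes k V E) = g_num n k"
    unfolding g_num_def mem_Collect_eq by metis
  show "uniform_hypergraph k V E \<Longrightarrow> card V = n \<Longrightarrow> card (clique_sizes k V E) \<le> g_num n k"
    unfolding g_num_def by (rule Max_ge[OF fin]) blast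
qed

lemma f_num_lower:
  assumes "k \<ge> 3" "n > 0"
  shows "\<exists>m. f_num n k = int m \<and> (\<forall>y\<ge>m. n \<le> (fast (k - 3) ^^ Suc m) y)"
proof -
  obtain V :: "nat set" and E where VE: "uniform_hypergraph k V E" "card V = n"
    "card (clique_sizes k V E) = g_num n k"
    using g_num_attained(1) by blast
  have "V \<noteq> {}" using VE assms by auto
  have "clique_sizes k V E \<subseteq> {1..n}"
  proof
    fix s assume s: "s \<in> clique_sizes k V E"
    moreover have "2 \<le> k" using assms(1) by simp
    ultimately have "s \<noteq> 0" using clique_sizes_pos[OF VE(1) _ \<open>V \<noteq> {}\<close>] by metis
    then show "s \<in> {1..n}" using clique_sizes_subset[OF VE(1)] s VE(2) by auto
  qed
  then have "card (clique_sizes k V E) \<le> card {1..n}" by (intro card_mono) auto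
  then have "g_num n k \<le> n" using VE(3) by simp
  then have "card V = (n - g_num n k) + card (clique_sizes k V E)" using VE by simp
  then have "n \<le> (fast (k - 3) ^^ Suc (n - g_num n k)) y" if "n - g_num n k \<le> y" for y
    using clique_sizes_bound[OF VE(1) assms(1) \<open>V \<noteq> {}\<close> _ that] VE(2) by simp
  moreover have "f_num n k = int (n - g_num n k)" using \<open>g_num n k \<le> n\<close> by (simp add: f_num_def)
  ultimately show ?thesis by blast
qed

section \<open>Hypergraphs with many clique sizes\<close>

text \<open>The vertex set is arbitrary so that it can be split as needed in recursive constructions.\<close>

definition realizable :: "nat \<Rightarrow> nat \<Rightarrow> nat set \<Rightarrow> bool" where
  "realizable k N S \<longleftrightarrow> (\<forall>V :: nat set. finite V \<and> card V = N \<longrightarrow>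
     (\<exists>E. uniform_hypergraph k V E \<and> S \<subseteq> clique_sizes k V E))"

lemma realizable_subset:
  assumes "realizable k N S" "S' \<subseteq> S"
  shows "realizable k N S'"
  unfolding realizable_def
proof (intro allI impI)
  fix V :: "nat set" assume "finite V \<and> card V = N"
  then obtain E where "uniform_hypergraph k V E" "S \<subseteq> clique_sizes k V E"
    using assms(1) unfolding realizable_def by blast
  then show "\<exists>E. uniform_hypergraph k V E \<and> S' \<subseteq> clique_sizes k V E" using assms(2) by blast
qed

lemma realizable_empty: "realizable k N {}"
  unfolding realizable_def uniform_hypergraph_def by (intro allI impI exI[of _ "{}"]) auto

lemma maximal_cliqueI:
  assumes "complete_set k V E X" "\<And>v. v \<in> V \<Longrightarrow> v \<notin> X \<Longrightarrow> \<not> complete_set k V E (insert v X)"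
  shows "maximal_clique k V E X"
  unfolding maximal_clique_def
proof (intro conjI allI impI assms(1))
  fix Y assume Y: "complete_set k V E Y \<and> X \<subseteq> Y"
  show "Y = X"
  proof (rule ccontr)
    assume "Y \<noteq> X"
    then obtain v where v: "v \<in> Y" "v \<notin> X" using Y by blast
    then have "insert v X \<subseteq> Y" using Y by blast
    then have "complete_set k V E (insert v X)"
      using Y order_trans unfolding complete_set_def by blast
    moreover have "v \<in> V" using Y v by (auto simp: complete_set_def)
    ultimately show False using assms(2) v by blast
  qed
qed

lemma maximal_clique_insert:
  assumes "maximal_clique k V E X" "v \<in> V" "v \<notin> X"
  shows "\<not> complete_set k V E (insert v X)"
  using assms by (auto simp: maximal_clique_def)

text \<open>Sets with fewer than \<open>k\<close> vertices are complete.\<close>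

lemma maximal_clique_large:
  assumes "maximal_clique k V E X" "finite V" "k \<le> Suc (card V)" "1 \<le> k"
  shows "k \<le> Suc (card X)"
proof (rule ccontr)
  assume small: "\<not> k \<le> Suc (card X)"
  have X: "X \<subseteq> V" using assms(1) by (simp add: maximal_clique_def complete_set_def)
  then have "finite X" using assms(2) finite_subset by blast
  have "card X < card V" using small assms(3) by simp
  then obtain v where v: "v \<in> V" "v \<notin> X" using X by (metis less_irrefl subset_antisym subsetI)
  have "complete_set k V E (insert v X)"
    unfolding complete_set_def
  proof (intro conjI allI impI)
    fix Y assume Y: "Y \<subseteq> insert v X \<and> card Y = k"
    then have "k \<le> card (insert v X)" using \<open>finite X\<close> by (auto intro: card_mono)
    then show "Y \<in> E" using small v \<open>finite X\<close> by simp
  qed (use X v in simp)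
  then show False using maximal_clique_insert[OF assms(1) v] by blast
qed

lemma realizable_single:
  assumes "1 \<le> k" "k \<le> t" "t \<le> N"
  shows "realizable k N {t}"
  unfolding realizable_def
proof (intro allI impI)
  fix V :: "nat set" assume V: "finite V \<and> card V = N"
  then obtain A where A: "A \<subseteq> V" "card A = t" using assms(3) obtain_subset_with_card_n by metis
  then have fin: "finite A" using V finite_subset by blast
  define E where "E = {e. e \<subseteq> A \<and> card e = k}"
  have "maximal_clique k V E A"
  proof (rule maximal_cliqueI)
    show "complete_set k V E A" using A by (auto simp: complete_set_def E_def)
    fix v assume v: "v \<in> V" "v \<notin> A"
    obtain B where B: "B \<subseteq> A" "card B = k - 1" using assms A obtain_subset_with_card_n by (metis diff_le_self order_trans)
    then have "v \<notin> B" "finite B" using v fin finite_subset by blast+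
    then have "card (insert v B) = k" using B assms by simp
    moreover have "insert v B \<notin> E" using v by (auto simp: E_def)
    moreover have "insert v B \<subseteq> insert v A" using B by blast
    ultimately show "\<not> complete_set k V E (insert v A)" unfolding complete_set_def by blast
  qed
  moreover have "uniform_hypergraph k V E" using V A by (auto simp: uniform_hypergraph_def E_def)
  ultimately show "\<exists>E. uniform_hypergraph k V E \<and> {t} \<subseteq> clique_sizes k V E"
    using A by (auto simp: clique_sizes_def intro!: exI[of _ E] image_eqI[of _ _ A])
qed

text \<open>Take \<open>r\<close> apices over a common complete base, and let the link of each apex in the base be one of
  the given hypergraphs. No edge contains two apices, so each apex together with a maximal clique
  of its link is a maximal clique.\<close>

lemma realizable_cone:
  assumes real: "\<And>j. j < r \<Longrightarrow> realizable k N (S j)" and k: "1 \<le> k" "k \<le> Suc N"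
  shows "realizable (Suc k) (N + r) (Suc ` (\<Union>j<r. S j))"
  unfolding realizable_def
proof (intro allI impI)
  fix V :: "nat set" assume V: "finite V \<and> card V = N + r"
  then obtain V0 where V0: "V0 \<subseteq> V" "card V0 = N" using obtain_subset_with_card_n[of N V] by auto
  define R where "R = V - V0"
  have fin: "finite V0" "finite R" using V V0 finite_subset by (auto simp: R_def)
  have "card R = r" using V V0 fin by (simp add: R_def card_Diff_subset)
  then obtain a where a: "bij_betw a {..<r} R" using fin by (metis ex_bij_betw_nat_finite atLeast0LessThan)
  have "\<forall>j\<in>{..<r}. \<exists>H. uniform_hypergraph k V0 H \<and> S j \<subseteq> clique_sizes k V0 H"
    using real V0 fin by (auto simp: realizable_def)
  then obtain H where H: "\<And>j. j < r \<Longrightarrow> uniform_hypergraph k V0 (H j)"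
    "\<And>j. j < r \<Longrightarrow> S j \<subseteq> clique_sizes k V0 (H j)" by (metis lessThan_iff)
  have aR: "a j \<in> V" "a j \<notin> V0" if "j < r" for j using a that by (auto simp: bij_betw_def R_def)
  have a_inj: "a i = a j \<longleftrightarrow> i = j" if "i < r" "j < r" for i j
    using a that by (auto simp: bij_betw_def inj_on_def)
  define E where "E = {e. e \<subseteq> V0 \<and> card e = Suc k} \<union> {insert (a j) e | j e. j < r \<and> e \<in> H j}"
  have H_edge: "e \<subseteq> V0" "card e = k" "finite e" if "e \<in> H j" "j < r" for e j
    using H(1)[OF that(2)] that(1) finite_subset[OF _ fin(1)] by (auto simp: uniform_hypergraph_def)
  have E_link: "insert (a j) e \<in> E \<longleftrightarrow> e \<in> H j" if jr: "j < r" and e0: "e \<subseteq> V0" for j e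
  proof
    assume "insert (a j) e \<in> E"
    then obtain i e' where *: "insert (a j) e = insert (a i) e'" "i < r" "e' \<in> H i"
      using aR[OF jr] by (auto simp: E_def)
    have "e' \<subseteq> V0" using H_edge * by blast
    then have "a j = a i" using *(1) aR[OF jr] aR[OF *(2)] by blast
    then have "i = j" using a_inj jr * by blast
    moreover have "a j \<notin> e" "a j \<notin> e'" using e0 \<open>e' \<subseteq> V0\<close> aR(2)[OF jr] by blast+
    then have "e = e'" using *(1) \<open>a j = a i\<close> insert_ident by metis
    ultimately show "e \<in> H j" using * by simp
  qed (use jr in \<open>auto simp: E_def\<close>)
  have E_two: "e \<notin> E" if ij: "a i \<in> e" "a j \<in> e" "i < r" "j < r" "i \<noteq> j" for e i j
  proof
    assume "e \<in> E"
    then obtain l e' where *: "e = insert (a l) e'" "l < r" "e' \<subseteq> V0"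
      using aR(2)[OF ij(3)] ij(1) H_edge(1) by (auto simp: E_def)
    then have "a i = a l" "a j = a l" using ij aR by blast+
    then show False using a_inj ij *(2) by metis
  qed
  have unif: "uniform_hypergraph (Suc k) V E"
    unfolding uniform_hypergraph_def
  proof (intro conjI ballI)
    fix e assume "e \<in> E"
    then consider "e \<subseteq> V0" "card e = Suc k" | j e' where "e = insert (a j) e'" "j < r" "e' \<in> H j"
      by (auto simp: E_def)
    then have "e \<subseteq> V \<and> card e = Suc k"
    proof cases
      case 2
      have "a j \<notin> e'" using aR(2)[OF 2(2)] H_edge[OF 2(3,2)] by blast
      then show ?thesis using aR(1)[OF 2(2)] H_edge[OF 2(3,2)] V0 2(1) by auto
    qed (use V0 in auto)
    then show "e \<subseteq> V" "card e = Suc k" by auto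
  qed (use V in simp)
  have "maximal_clique (Suc k) V E (insert (a j) A)"
    if j: "j < r" and A: "maximal_clique k V0 (H j) A" for j A
  proof (rule maximal_cliqueI)
    have AV: "A \<subseteq> V0" and AH: "\<And>Y. Y \<subseteq> A \<Longrightarrow> card Y = k \<Longrightarrow> Y \<in> H j"
      using A by (auto simp: maximal_clique_def complete_set_def)
    have "finite A" using AV fin finite_subset by blast
    have k_A: "k \<le> Suc (card A)" using maximal_clique_large[OF A fin(1)] k V0 by simp
    show "complete_set (Suc k) V E (insert (a j) A)"
      unfolding complete_set_def
    proof (intro conjI allI impI)
      show "insert (a j) A \<subseteq> V" using AV V0 aR[OF j] by auto
      fix Y assume Y: "Y \<subseteq> insert (a j) A \<and> card Y = Suc k"
      show "Y \<in> E"
      proof (cases "a j \<in> Y")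
        case True
        have "card (Y - {a j}) = k" using Y True by (simp add: card_Diff_singleton)
        then have "Y - {a j} \<in> H j" using Y by (intro AH) auto
        then have "insert (a j) (Y - {a j}) \<in> E" using j unfolding E_def by blast
        then show ?thesis using True by (simp add: insert_absorb)
      next
        case False
        then show ?thesis using Y AV unfolding E_def by blast
      qed
    qed
    fix v assume v: "v \<in> V" "v \<notin> insert (a j) A"
    show "\<not> complete_set (Suc k) V E (insert v (insert (a j) A))"
    proof (cases "v \<in> V0")
      case True
      then have "\<not> complete_set k V0 (H j) (insert v A)" using maximal_clique_insert[OF A] v by blast
      then obtain Y where Y: "Y \<subseteq> insert v A" "card Y = k" "Y \<notin> H j"
        using True AV by (auto simp: complete_set_def)
      have Y0: "Y \<subseteq> V0" using Y(1) True AV by blast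
      then have "insert (a j) Y \<notin> E" using E_link[OF j] Y(3) by blast
      moreover have "card (insert (a j) Y) = Suc k"
        using Y(2) Y0 aR(2)[OF j] card_insert_disjoint[OF finite_subset[OF Y0 fin(1)], of "a j"] by auto
      moreover have "insert (a j) Y \<subseteq> insert v (insert (a j) A)" using Y(1) by blast
      ultimately show ?thesis unfolding complete_set_def by blast
    next
      case False
      then obtain i where i: "i < r" "v = a i" using v a by (auto simp: bij_betw_def R_def)
      have "k - 1 \<le> card A" using k_A by simp
      then obtain B where B: "B \<subseteq> A" "card B = k - 1" "finite B"
        using obtain_subset_with_card_n by blast
      have "card (insert v (insert (a j) B)) = Suc k"
        using B AV aR[OF j] False v k by (auto simp: card_insert_if)
      moreover have "insert v (insert (a j) B) \<notin> E"
        using E_two[of i _ j] i j v by blast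
      moreover have "insert v (insert (a j) B) \<subseteq> insert v (insert (a j) A)" using B by blast
      ultimately show ?thesis unfolding complete_set_def by blast
    qed
  qed
  note max = this
  have "Suc s \<in> clique_sizes (Suc k) V E" if js: "j < r" "s \<in> S j" for j s
  proof -
    obtain A where A: "maximal_clique k V0 (H j) A" "s = card A"
      using H(2)[OF js(1)] js(2) by (auto simp: clique_sizes_def)
    have AV: "A \<subseteq> V0" using A by (simp add: maximal_clique_def complete_set_def)
    then have "a j \<notin> A" using aR(2)[OF js(1)] by blast
    then have "card (insert (a j) A) = Suc s"
      using A(2) finite_subset[OF AV fin(1)] by simp
    then show ?thesis using max[OF js(1) A(1)] unfolding clique_sizes_def by force
  qed
  then show "\<exists>E. uniform_hypergraph (Suc k) V E \<and> Suc ` (\<Union>j<r. S j) \<subseteq> clique_sizes (Suc k) V E"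
    using unif by (intro exI[of _ E]) auto
qed

text \<open>The complement of the graph gains a disjoint star with centre \<open>c\<close> and leaves \<open>L\<close>. Cliques are
  independent sets of the complement, so a maximal one extends by all of \<open>L\<close> or by \<open>c\<close> alone.\<close>

lemma star_join:
  fixes V :: "'a set"
  assumes V: "finite V" "V = V' \<union> insert c L" "V' \<inter> insert c L = {}" "c \<notin> L" "L \<noteq> {}"
    and E': "uniform_hypergraph 2 V' E'" and A: "maximal_clique 2 V' E' A"
  defines "E \<equiv> E' \<union> {{u, v} | u v. u \<in> V' \<and> v \<in> insert c L} \<union> {{u, v} | u v. u \<in> L \<and> v \<in> L \<and> u \<noteq> v}"
  shows "maximal_clique 2 V E (A \<union> L)" and "maximal_clique 2 V E (insert c A)"
    and "uniform_hypergraph 2 V E"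
proof -
  have pair: "complete_set 2 V E X \<longleftrightarrow> X \<subseteq> V \<and> (\<forall>u\<in>X. \<forall>v\<in>X. u \<noteq> v \<longrightarrow> {u, v} \<in> E)" for V :: "'a set" and E X
  proof
    assume *: "complete_set 2 V E X"
    then have "{u, v} \<in> E" if "u \<in> X" "v \<in> X" "u \<noteq> v" for u v
      using that unfolding complete_set_def by (metis card_2_iff empty_subsetI insert_subset)
    then show "X \<subseteq> V \<and> (\<forall>u\<in>X. \<forall>v\<in>X. u \<noteq> v \<longrightarrow> {u, v} \<in> E)" using * by (simp add: complete_set_def)
  qed (auto simp: complete_set_def card_2_iff)
  have nonedge: "\<not> complete_set 2 V E X" if "u \<in> X" "w \<in> X" "u \<noteq> w" "{u, w} \<notin> E"
    for V :: "'a set" and E X u w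
    using that by (auto simp: pair)
  have AV: "A \<subseteq> V'" and AE: "\<And>u v. u \<in> A \<Longrightarrow> v \<in> A \<Longrightarrow> u \<noteq> v \<Longrightarrow> {u, v} \<in> E'"
    using A by (auto simp: maximal_clique_def pair)
  have E'V: "e \<subseteq> V'" if "e \<in> E'" for e using E' that by (simp add: uniform_hypergraph_def)
  have cross: "{u, v} \<in> E" "{v, u} \<in> E" if "u \<in> V'" "v \<in> insert c L" for u v
    using that by (auto simp: E_def insert_commute)
  have L_E: "{u, v} \<in> E" if "u \<in> L" "v \<in> L" "u \<noteq> v" for u v using that by (auto simp: E_def)
  have cL: "{c, u} \<notin> E" if "u \<in> L" for u
    using that V E'V by (auto simp: E_def doubleton_eq_iff)
  have E_V': "{u, v} \<in> E' \<longleftrightarrow> {u, v} \<in> E" if "u \<in> V'" "v \<in> V'" for u v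
    using that V by (auto simp: E_def doubleton_eq_iff)
  have extend: "\<not> complete_set 2 V E (insert v (A \<union> B))" if v: "v \<in> V'" "v \<notin> A" for v B
  proof -
    have "\<not> complete_set 2 V' E' (insert v A)" using maximal_clique_insert[OF A] v by blast
    then obtain u w where uw: "u \<in> insert v A" "w \<in> insert v A" "u \<noteq> w" "{u, w} \<notin> E'"
      using v AV by (auto simp: pair)
    then have "{u, w} \<notin> E" using E_V'[of u w] v AV by blast
    then show ?thesis using uw by (intro nonedge[of u _ w]) auto
  qed
  show "maximal_clique 2 V E (A \<union> L)"
  proof (rule maximal_cliqueI)
    show "complete_set 2 V E (A \<union> L)"
      unfolding pair
    proof (intro conjI ballI impI)
      show "A \<union> L \<subseteq> V" using AV V(2) by blast
      fix u v assume "u \<in> A \<union> L" "v \<in> A \<union> L" "u \<noteq> v"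
      then consider "u \<in> A" "v \<in> A" | "u \<in> V'" "v \<in> insert c L" | "v \<in> V'" "u \<in> insert c L"
        | "u \<in> L" "v \<in> L" using AV by blast
      then show "{u, v} \<in> E"
        by cases (use AE[of u v] E_V'[of u v] cross[of u v] cross[of v u] L_E[of u v] \<open>u \<noteq> v\<close> AV in blast)+
    qed
    fix v assume v: "v \<in> V" "v \<notin> A \<union> L"
    show "\<not> complete_set 2 V E (insert v (A \<union> L))"
    proof (cases "v = c")
      case True
      obtain u where "u \<in> L" using V(5) by blast
      then show ?thesis using cL[of u] True V(4) by (intro nonedge[of c _ u]) auto
    next
      case False
      then have "v \<in> V'" "v \<notin> A" using v V(2) by auto
      then show ?thesis by (rule extend)
    qed
  qed
  show "maximal_clique 2 V E (insert c A)"
  proof (rule maximal_cliqueI)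
    show "complete_set 2 V E (insert c A)"
      unfolding pair
    proof (intro conjI ballI impI)
      show "insert c A \<subseteq> V" using AV V(2) by blast
      fix u v assume "u \<in> insert c A" "v \<in> insert c A" "u \<noteq> v"
      then consider "u \<in> A" "v \<in> A" | "u \<in> V'" "v = c" | "v \<in> V'" "u = c" using AV by blast
      then show "{u, v} \<in> E"
        by cases (use AE[of u v] E_V'[of u v] cross[of u v] cross[of v u] \<open>u \<noteq> v\<close> AV in blast)+
    qed
    fix v assume v: "v \<in> V" "v \<notin> insert c A"
    show "\<not> complete_set 2 V E (insert v (insert c A))"
    proof (cases "v \<in> L")
      case True
      then show ?thesis using cL[of v] V(4) by (intro nonedge[of c _ v]) auto
    next
      case False
      then have "v \<in> V'" "v \<notin> A" using v V(2) by auto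
      then show ?thesis using extend[of v "{c}"] by simp
    qed
  qed
  show "uniform_hypergraph 2 V E"
    unfolding uniform_hypergraph_def
  proof (intro conjI ballI)
    fix e assume "e \<in> E"
    then consider "e \<in> E'" | u v where "e = {u, v}" "u \<in> V'" "v \<in> insert c L"
      | u v where "e = {u, v}" "u \<in> L" "v \<in> L" "u \<noteq> v"
      unfolding E_def by blast
    then have "e \<subseteq> V \<and> card e = 2"
    proof cases
      case 1
      then show ?thesis using E' V(2) by (auto simp: uniform_hypergraph_def)
    next
      case 2
      then have "u \<noteq> v" using V(3) by blast
      then show ?thesis using 2 V(2) by auto
    qed (use V(2) in auto)
    then show "e \<subseteq> V" "card e = 2" by auto
  qed (rule V(1))
qed

text \<open>In the complement, \<open>s\<close> stars are used. The star with \<open>a + 1\<close> leaves costs a clique either \<open>1\<close> or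
  \<open>1 + a\<close> vertices. Halving \<open>M\<close> repeatedly yields numbers \<open>a\<close> whose subset sums fill \<open>{0..M}\<close>.\<close>

lemma realizable_graph:
  assumes "2 * s + M \<le> N" "M < 2 ^ s"
  shows "realizable 2 N {N - s - M..N - s}"
  using assms
proof (induction s arbitrary: M N)
  case 0
  have "realizable 2 N {N}"
    unfolding realizable_def
  proof (intro allI impI)
    fix V :: "nat set" assume V: "finite V \<and> card V = N"
    define E where "E = {e. e \<subseteq> V \<and> card e = 2}"
    have "maximal_clique 2 V E V" by (auto simp: maximal_clique_def complete_set_def E_def)
    then show "\<exists>E. uniform_hypergraph 2 V E \<and> {N} \<subseteq> clique_sizes 2 V E"
      using V by (intro exI[of _ E]) (auto simp: uniform_hypergraph_def clique_sizes_def E_def)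
  qed
  then show ?case using 0 by simp
next
  case (Suc s)
  \<comment> \<open>Subset sums that fill \<open>{0..M1}\<close> fill \<open>{0..M1 + a}\<close> after adding \<open>a\<close>, because \<open>a \<le> M1 + 1\<close>.\<close>
  define M1 where "M1 = M div 2"
  define a where "a = M - M1"
  define N' where "N' = N - a - 2"
  have arith: "M = M1 + a" "M1 \<le> a" "a \<le> Suc M1" "M1 < 2 ^ s" "2 * s + M1 \<le> N'" "N = N' + a + 2"
    using Suc.prems by (auto simp: M1_def a_def N'_def)
  have IH: "realizable 2 N' {N' - s - M1..N' - s}" using Suc.IH arith by blast
  show ?case
    unfolding realizable_def
  proof (intro allI impI)
    fix V :: "nat set" assume V: "finite V \<and> card V = N"
    obtain V' where V': "V' \<subseteq> V" "card V' = N'" using obtain_subset_with_card_n[of N' V] V arith by auto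
    have finV': "finite V'" using V' V finite_subset by blast
    have rest: "card (V - V') = a + 2" using V V' arith finV' by (simp add: card_Diff_subset)
    then have "V - V' \<noteq> {}" by (metis card.empty add_is_0 zero_neq_numeral)
    then obtain c where c: "c \<in> V - V'" by blast
    define L where "L = V - V' - {c}"
    have L: "card L = Suc a" using rest c V by (simp add: L_def)
    then have "L \<noteq> {}" by auto
    obtain E' where E': "uniform_hypergraph 2 V' E'" "{N' - s - M1..N' - s} \<subseteq> clique_sizes 2 V' E'"
      using IH V' finV' by (auto simp: realizable_def)
    have split: "V = V' \<union> insert c L" "V' \<inter> insert c L = {}" "c \<notin> L"
      using V' c by (auto simp: L_def)
    define E where "E = E' \<union> {{u, v} | u v. u \<in> V' \<and> v \<in> insert c L} \<union>
      {{u, v} | u v. u \<in> L \<and> v \<in> L \<and> u \<noteq> v}"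
    have "finite V" using V by simp
    note star = star_join[OF \<open>finite V\<close> split \<open>L \<noteq> {}\<close> E'(1), folded E_def]
    have "x \<in> clique_sizes 2 V E" if x: "x \<in> {N - Suc s - M..N - Suc s}" for x
    proof -
      have x': "N - Suc s - M \<le> x" "x \<le> N - Suc s" using x by auto
      define y where "y = (if N' - s - M1 + Suc a \<le> x then x - Suc a else x - 1)"
      have y: "y \<in> {N' - s - M1..N' - s}" "x = (if N' - s - M1 + Suc a \<le> x then y + Suc a else y + 1)"
        using x' arith by (auto simp: y_def)
      obtain A where A: "maximal_clique 2 V' E' A" "y = card A"
        using y(1) E'(2) by (auto simp: clique_sizes_def)
      have AV: "A \<subseteq> V'" using A by (simp add: maximal_clique_def complete_set_def)
      then have "finite A" using finV' finite_subset by blast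
      have "A \<inter> L = {}" "finite L" using AV \<open>finite V\<close> by (auto simp: L_def)
      then have "card (A \<union> L) = y + Suc a"
        using card_Un_disjoint[OF \<open>finite A\<close>, of L] A(2) L by simp
      moreover have "card (insert c A) = y + 1"
        using A(2) AV c card_insert_disjoint[OF \<open>finite A\<close>, of c] by auto
      moreover have "card (A \<union> L) \<in> clique_sizes 2 V E" "card (insert c A) \<in> clique_sizes 2 V E"
        using star(1,2)[OF A(1)] by (auto simp: clique_sizes_def)
      ultimately show ?thesis using y(2) by (metis (full_types))
    qed
    moreover have "N' - s \<in> clique_sizes 2 V' E'" using E'(2) by auto
    then obtain A where "maximal_clique 2 V' E' A" unfolding clique_sizes_def by blast
    then have "uniform_hypergraph 2 V E" by (rule star(3))
    ultimately show "\<exists>E. uniform_hypergraph 2 V E \<and> {N - Suc s - M..N - Suc s} \<subseteq> clique_sizes 2 V E"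
      by blast
  qed
qed

lemma ex_bracket:
  fixes f :: "nat \<Rightarrow> nat"
  assumes "f 0 \<le> x" "x \<le> f r" "1 \<le> r"
  shows "\<exists>j<r. f j \<le> x \<and> x \<le> f (Suc j)"
  using assms
proof (induction r)
  case (Suc r)
  show ?case
  proof (cases "f r \<le> x")
    case False
    then have "r \<noteq> 0" using Suc.prems(1) by (cases r) auto
    then obtain j where "j < r" "f j \<le> x" "x \<le> f (Suc j)"
      using Suc.IH Suc.prems(1) False by auto
    then show ?thesis using less_SucI by blast
  qed (use Suc.prems in blast)
qed simp

text \<open>With \<open>s\<close> apices, a clique of loss \<open>l\<close> in a link has loss \<open>l + s - 1\<close> in the cone. The link of the \<open>j\<close>-th
  apex covers the losses from \<open>b j = (slow i ^^ j) 1\<close> to \<open>b (Suc j)\<close>, so that \<open>s\<close> apices reach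
  \<open>b s = slow (Suc i) s\<close>. Passing to the base costs a vertex at each level even for \<open>s = 1\<close>; hence
  the summand \<open>i\<close>.\<close>

lemma realizable_top_sizes:
  assumes "2 * M + i \<le> N" "M \<le> slow i s" "1 \<le> s" "s \<le> M"
  shows "realizable (i + 2) N {N - M..N - s}"
  using assms
proof (induction i arbitrary: M N s)
  case 0
  have "realizable 2 N {N - s - (M - s)..N - s}" using 0 by (intro realizable_graph) auto
  moreover have "N - s - (M - s) = N - M" using 0 by simp
  ultimately show ?case by (simp add: numeral_2_eq_2)
next
  case (Suc i)
  define N0 where "N0 = N - s"
  define b where "b = (\<lambda>j. (slow i ^^ j) 1)"
  define m where "m = (\<lambda>j. min (b (Suc j)) (M - s + 1))"
  define S where "S = (\<lambda>j. if b j \<le> m j then {N0 - m j..N0 - b j} else {})"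
  have b_ge: "1 \<le> b j" for j unfolding b_def by (rule le_funpow[OF le_slow])
  have "realizable (i + 2) N0 (S j)" for j
  proof (cases "b j \<le> m j")
    case True
    have "m j \<le> M - s + 1" "m j \<le> slow i (b j)" by (simp_all add: m_def b_def)
    moreover have "2 * (M - s + 1) + i \<le> N0" using Suc.prems by (simp add: N0_def)
    ultimately show ?thesis using True b_ge Suc.IH[of "m j" N0 "b j"] by (simp add: S_def)
  qed (simp add: S_def realizable_empty)
  then have "realizable (Suc (i + 2)) (N0 + s) (Suc ` (\<Union>j<s. S j))"
    using Suc.prems by (intro realizable_cone) (auto simp: N0_def)
  moreover have "N0 + s = N" using Suc.prems by (simp add: N0_def)
  moreover have "{N - M..N - s} \<subseteq> Suc ` (\<Union>j<s. S j)"
  proof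
    fix y assume y: "y \<in> {N - M..N - s}"
    define l where "l = N - y - s + 1"
    have l: "1 \<le> l" "l \<le> M - s + 1" "y = Suc (N0 - l)" "l \<le> M"
      using y Suc.prems by (auto simp: l_def N0_def)
    have "b 0 \<le> l" "l \<le> b s" using l Suc.prems(2) by (auto simp: b_def)
    then obtain j where j: "j < s" "b j \<le> l" "l \<le> b (Suc j)" using ex_bracket[of b l s] Suc.prems(3) by blast
    then have "l \<le> m j" using l by (simp add: m_def)
    then have "N0 - l \<in> S j" using j by (auto simp: S_def intro: diff_le_mono2)
    then show "y \<in> Suc ` (\<Union>j<s. S j)" using j(1) l(3) by blast
  qed
  ultimately show ?case using realizable_subset by simp
qed

text \<open>A cone whose links have a single nontrivial clique each, of consecutive sizes.\<close>

lemma realizable_bottom_sizes: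
  assumes "1 \<le> k" "r \<le> N" "k \<le> Suc (N - r)"
  shows "realizable (Suc k) N {Suc k..min (k + r) (Suc (N - r))}"
proof -
  define S where "S = (\<lambda>j. if k + j \<le> N - r then {k + j} else {})"
  have "realizable (Suc k) (N - r + r) (Suc ` (\<Union>j<r. S j))"
    using assms by (intro realizable_cone) (auto simp: S_def intro: realizable_single realizable_empty)
  moreover have "{Suc k..min (k + r) (Suc (N - r))} \<subseteq> Suc ` (\<Union>j<r. S j)"
  proof
    fix y assume y: "y \<in> {Suc k..min (k + r) (Suc (N - r))}"
    then have "y - 1 \<in> S (y - 1 - k)" "y - 1 - k < r" "y = Suc (y - 1)" by (auto simp: S_def)
    then show "y \<in> Suc ` (\<Union>j<r. S j)" by blast
  qed
  ultimately show ?thesis using realizable_subset assms(2) by simp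
qed

text \<open>One cone over \<open>N\<close> vertices with \<open>r + 1\<close> apices: the first \<open>r\<close> links provide the large sizes as in the
  lemma on top sizes, cut off at half of \<open>N\<close>, and the last link provides the small sizes.\<close>

lemma realizable_almost_all:
  assumes "n \<le> (slow i ^^ r) 1" "r + i + 3 < n"
  shows "realizable (i + 3) n {i + 3..n - r - 1}"
proof -
  define N where "N = n - Suc r"
  define h where "h = (N - i) div 2"
  define b where "b = (\<lambda>j. (slow i ^^ j) 1)"
  define m where "m = (\<lambda>j. min (b (Suc j)) h)"
  define S where "S = (\<lambda>j. if j = r then {i + 2..min (i + 1 + h) (Suc (N - h))}
    else if b j \<le> m j then {N - m j..N - b j} else {})"
  have N: "i + 3 \<le> N" "n = N + Suc r" using assms(2) by (auto simp: N_def)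
  have h: "2 * h + i \<le> N" "N \<le> 2 * h + i + 1" using N by (auto simp: h_def)
  have b_ge: "1 \<le> b j" for j unfolding b_def by (rule le_funpow[OF le_slow])
  have "r \<noteq> 0" using assms by (intro notI) simp
  have "realizable (i + 2) N (S j)" for j
  proof -
    have "realizable (Suc (i + 1)) N {Suc (i + 1)..min (i + 1 + h) (Suc (N - h))}"
      using h by (intro realizable_bottom_sizes) auto
    moreover have "realizable (i + 2) N {N - m j..N - b j}" if "b j \<le> m j"
    proof (rule realizable_top_sizes[OF _ _ b_ge that])
      show "m j \<le> slow i (b j)" by (simp add: m_def b_def)
      have "m j \<le> h" by (simp add: m_def)
      then show "2 * m j + i \<le> N" using h by linarith
    qed
    ultimately show ?thesis by (auto simp: S_def realizable_empty)
  qed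
  then have "realizable (Suc (i + 2)) (N + Suc r) (Suc ` (\<Union>j<Suc r. S j))"
    using N by (intro realizable_cone) auto
  moreover have "{i + 3..n - r - 1} \<subseteq> Suc ` (\<Union>j<Suc r. S j)"
  proof
    fix y assume y: "y \<in> {i + 3..n - r - 1}"
    define t where "t = y - 1"
    have t: "y = Suc t" "i + 2 \<le> t" "t < N" using y N by (auto simp: t_def)
    have "\<exists>j<Suc r. t \<in> S j"
    proof (cases "N - t \<le> h")
      case True
      have "b 0 \<le> N - t" "N - t \<le> b r" using t N assms(1) by (auto simp: b_def)
      then obtain j where j: "j < r" "b j \<le> N - t" "N - t \<le> b (Suc j)"
        using ex_bracket[of b "N - t" r] \<open>r \<noteq> 0\<close> by auto
      then have "N - t \<le> m j" using True by (simp add: m_def)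
      then have "t \<in> S j" using j t by (auto simp: S_def)
      then show ?thesis using j(1) less_SucI by blast
    next
      case False
      then have "t \<in> S r" using t h by (auto simp: S_def)
      then show ?thesis by blast
    qed
    then show "y \<in> Suc ` (\<Union>j<Suc r. S j)" using t(1) by blast
  qed
  ultimately show ?thesis using realizable_subset N(2) by (simp add: numeral_3_eq_3)
qed

section \<open>Comparing the three quantities\<close>

lemma f_num_upper:
  assumes "n \<le> (slow i ^^ r) 1"
  shows "f_num n (i + 3) \<le> int (r + i + 3)"
proof (cases "r + i + 3 < n")
  case True
  then have "realizable (i + 3) n {i + 3..n - r - 1}" using assms by (rule realizable_almost_all[rotated])
  then obtain E where E: "uniform_hypergraph (i + 3) {..<n} E"
    "{i + 3..n - r - 1} \<subseteq> clique_sizes (i + 3) {..<n} E"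
    unfolding realizable_def by (metis card_lessThan finite_lessThan)
  have fin: "finite (clique_sizes (i + 3) {..<n} E)"
    using clique_sizes_subset[OF E(1)] finite_subset by blast
  have "card {i + 3..n - r - 1} \<le> card (clique_sizes (i + 3) {..<n} E)" by (rule card_mono[OF fin E(2)])
  also have "\<dots> \<le> g_num n (i + 3)" by (rule g_num_attained(2)[OF E(1)]) simp
  finally show ?thesis using True by (simp add: f_num_def)
qed (simp add: f_num_def)

lemma double_le_fast: "2 * y \<le> fast i y"
proof (induction i arbitrary: y)
  case 0
  show ?case using le_tower3_quadratic[of y] by simp
next
  case (Suc i)
  have "1 \<le> tower3 y" by (simp add: tower3_def)
  then have "(fast i ^^ 1) y \<le> (fast i ^^ tower3 y) y"
    by (intro funpow_le_funpow fast_mono le_fast) auto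
  then show ?case using Suc[of y] by simp
qed

text \<open>The term \<open>n - C\<close> in the definition of \<open>c\<close> costs one further application of \<open>fast\<close>.\<close>

lemma
  assumes "k \<ge> 3"
  shows c_num_upper: "n \<le> (slow (k - 3) ^^ 2 ^ C) 1 \<Longrightarrow> c_num n k \<le> C"
    and c_num_lower: "n \<le> (fast (k - 3) ^^ (2 ^ c_num n k + 2)) (2 ^ c_num n k + 16)"
proof -
  have d: "2 \<le> k - 1" "k - 1 - 2 = k - 3" using assms by auto
  show "c_num n k \<le> C" if "n \<le> (slow (k - 3) ^^ 2 ^ C) 1"
    unfolding c_num_def
  proof (rule Least_le)
    have "n \<le> N0 (k - 1) C" using that slow_le_N0[OF d(1), of C] d(2) by simp
    then show "int n - int C \<le> int (N0 (k - 1) C)" by simp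
  qed
  define c where "c = c_num n k"
  define y where "y = (2::nat) ^ c + 16"
  define z where "z = (fast (k - 3) ^^ Suc (2 ^ c)) y"
  have "int n - int c \<le> int (N0 (k - 1) c)"
    unfolding c_def c_num_def by (rule LeastI[of _ n]) simp
  moreover have "N0 (k - 1) c \<le> z" using N0_le[OF d(1), of c y] d(2) by (simp add: y_def z_def)
  ultimately have "n \<le> z + c" by linarith
  also have "c \<le> y" using Suc_le_two_pow[of c] by (simp add: y_def)
  also have "y \<le> z" unfolding z_def by (rule le_funpow[OF le_fast])
  also have "z + z \<le> fast (k - 3) z" using double_le_fast[of z "k - 3"] by simp
  finally show "n \<le> (fast (k - 3) ^^ (2 ^ c_num n k + 2)) (2 ^ c_num n k + 16)"
    by (simp add: z_def y_def c_def)
qed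

lemma ex_two_pow_between: "1 \<le> m \<Longrightarrow> \<exists>C. m \<le> 2 ^ C \<and> 2 ^ C \<le> 2 * (m :: nat)"
proof (induction m rule: nat_induct_at_least)
  case base
  show ?case by (intro exI[of _ 0]) simp
next
  case (Suc m)
  then obtain C where C: "m \<le> 2 ^ C" "2 ^ C \<le> 2 * m" by blast
  show ?case
  proof (cases "Suc m \<le> 2 ^ C")
    case True
    then show ?thesis using C by (intro exI[of _ C]) simp
  next
    case False
    then show ?thesis using C Suc by (intro exI[of _ "Suc C"]) simp
  qed
qed

theorem theorem1p1:
  fixes k :: nat
  assumes "k \<ge> 3"
  shows "(\<lambda>n. real_of_int (f_num n k)) \<in> \<Theta>(\<lambda>n. L_fun k (real n)) \<and>
         (\<lambda>n. real (c_num n k) - log 2 (L_fun k (real n))) \<in> O(\<lambda>_. 1) \<and>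
         (\<lambda>n. real_of_int (f_num n k)) \<in> \<Theta>(\<lambda>n. 2 ^ c_num n k)"
proof -
  define i where "i = k - 3"
  have k: "k = i + 3" "k - 2 = Suc i" using assms by (auto simp: i_def)
  have L: "L_fun k = L_shift (Suc i)" by (simp add: L_fun_def k)
  \<comment> \<open>\<open>L_k\<close> takes natural values since \<open>k \<ge> 3\<close>.\<close>
  define l where "l = (\<lambda>n::nat. nat \<lfloor>L_fun k (real n)\<rfloor>)"
  have l: "L_fun k (real n) = real (l n)" for n
    using L_shift_Suc_nat[of i "real n"] by (auto simp: l_def L)
  obtain c where c: "\<And>n. n \<le> (slow i ^^ (2 * l n + c)) 1"
  proof -
    obtain c where "\<And>x t. L_shift (Suc i) x \<le> real t \<Longrightarrow> x \<le> real ((slow i ^^ (2 * t + c)) 1)"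
      using slow_catches_up[of i] by blast
    moreover have "L_shift (Suc i) (real n) \<le> real (l n)" for n
      using l[of n] unfolding L by (rule eq_refl)
    ultimately have "real n \<le> real ((slow i ^^ (2 * l n + c)) 1)" for n by blast
    then show thesis using that of_nat_le_iff by blast
  qed
  \<comment> \<open>\<open>L_k\<close> is unbounded, so additive constants can be absorbed.\<close>
  have large: "\<forall>\<^sub>F n in sequentially. t \<le> l n" for t
  proof (rule eventually_mono[OF eventually_gt_at_top[of "(slow i ^^ (2 * t + c)) 1"]])
    fix n assume n: "(slow i ^^ (2 * t + c)) 1 < n"
    show "t \<le> l n"
    proof (rule ccontr)
      assume "\<not> t \<le> l n"
      then have "(slow i ^^ (2 * l n + c)) 1 \<le> (slow i ^^ (2 * t + c)) 1"
        by (intro funpow_le_funpow slow_mono le_slow) auto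
      then show False using c[of n] n by simp
    qed
  qed
  have f_up: "f_num n k \<le> int (2 * l n + c + k)" for n
    using f_num_upper[OF c[of n]] by (simp add: k add.assoc)
  have f_low: "int (l n) \<le> 6 * f_num n k + 21 \<and> 0 \<le> f_num n k" if n: "0 < n" for n
  proof -
    obtain m where m: "f_num n k = int m" "n \<le> (fast i ^^ Suc m) (m + 16)"
      using f_num_lower[OF assms n] unfolding i_def by (metis le_add1)
    have "L_shift (Suc i) (real n) \<le> real (5 * Suc m + (m + 16))"
      using m(2) by (rule L_shift_fast_bound) simp
    then have "l n \<le> 5 * Suc m + (m + 16)" using l[of n] by (simp add: L del: L_shift.simps)
    then show ?thesis using m(1) by simp
  qed
  have c_up: "2 ^ c_num n k \<le> 2 * (2 * l n + c + 1)" for n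
  proof -
    obtain C where C: "2 * l n + c + 1 \<le> 2 ^ C" "2 ^ C \<le> 2 * (2 * l n + c + 1)"
      using ex_two_pow_between[of "2 * l n + c + 1"] by auto
    have "n \<le> (slow i ^^ 2 ^ C) 1"
      using c[of n] by (rule order_trans) (use C in \<open>intro funpow_le_funpow slow_mono le_slow; simp\<close>)
    then have "c_num n k \<le> C" using c_num_upper[OF assms, of n C] by (simp add: i_def)
    then have "(2::nat) ^ c_num n k \<le> 2 ^ C" by (rule power_increasing) simp
    then show ?thesis using C(2) by linarith
  qed
  have c_low: "l n \<le> 32 * 2 ^ c_num n k" for n
  proof -
    have "L_shift (Suc i) (real n) \<le> real (5 * (2 ^ c_num n k + 2) + (2 ^ c_num n k + 16))"
      using c_num_lower[OF assms, of n] unfolding i_def by (rule L_shift_fast_bound) simp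
    then have "l n \<le> 5 * (2 ^ c_num n k + 2) + (2 ^ c_num n k + 16)"
      using l[of n] by (simp add: L del: L_shift.simps of_nat_add of_nat_mult)
    moreover have "5 * (x + 2) + (x + 16) \<le> 32 * x" if "1 \<le> x" for x :: nat
      using that by simp
    ultimately show ?thesis using order_trans by (metis one_le_numeral one_le_power)
  qed
  define K where "K = 6 + 2 * c + k"
  have K: "2 * l n + c + k \<le> K * l n" "2 * (2 * l n + c + 1) \<le> K * l n" if "1 \<le> l n" for n
  proof -
    have ge: "c \<le> c * l n" "k \<le> k * l n" using that by auto
    have eq: "K * l n = 6 * l n + 2 * (c * l n) + k * l n" by (simp add: K_def algebra_simps)
    show "2 * l n + c + k \<le> K * l n" using ge eq by linarith
    have "2 * (2 * l n + c + 1) \<le> 6 * l n + 2 * c" using that by simp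
    then show "2 * (2 * l n + c + 1) \<le> K * l n" using ge eq by linarith
  qed
  have f_theta: "(\<lambda>n. real_of_int (f_num n k)) \<in> \<Theta>(\<lambda>n. L_fun k (real n))"
  proof (rule bigthetaI)
    have "norm (real_of_int (f_num n k)) \<le> real K * norm (L_fun k (real n))" if "42 \<le> l n" "0 < n" for n
    proof -
      have "f_num n k \<le> int (K * l n)" using f_up[of n] K(1)[of n] that(1) by linarith
      then have "real_of_int (f_num n k) \<le> real_of_int (int (K * l n))" by (subst of_int_le_iff)
      then show ?thesis using f_low[OF that(2)] by (simp add: l)
    qed
    then show "(\<lambda>n. real_of_int (f_num n k)) \<in> O(\<lambda>n. L_fun k (real n))"
      using eventually_conj[OF large[of 42] eventually_gt_at_top[of 0]]
      by (intro bigoI[of _ "real K"]) (auto elim: eventually_mono)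
    have "1 / 12 * norm (L_fun k (real n)) \<le> norm (real_of_int (f_num n k))" if "42 \<le> l n \<and> 0 < n" for n
    proof -
      have "int (l n) \<le> 12 * f_num n k" using f_low[of n] that by linarith
      then have "real_of_int (int (l n)) \<le> real_of_int (12 * f_num n k)" by (subst of_int_le_iff)
      then show ?thesis using f_low[of n] that by (simp add: l)
    qed
    then show "(\<lambda>n. real_of_int (f_num n k)) \<in> \<Omega>(\<lambda>n. L_fun k (real n))"
      by (intro landau_omega.bigI[of "1 / 12"]
          eventually_mono[OF eventually_conj[OF large[of 42] eventually_gt_at_top[of 0]]]) simp_all
  qed
  have two_up: "2 ^ c_num n k \<le> real K * real (l n)" if "1 \<le> l n" for n
  proof -
    have "2 ^ c_num n k \<le> K * l n" using c_up[of n] K(2)[OF that] by linarith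
    then have "real (2 ^ c_num n k) \<le> real (K * l n)" by (subst of_nat_le_iff)
    then show ?thesis by simp
  qed
  have two_low: "real (l n) \<le> 32 * 2 ^ c_num n k" for n
  proof -
    have "real (l n) \<le> real (32 * 2 ^ c_num n k)" using c_low[of n] by (subst of_nat_le_iff)
    then show ?thesis by simp
  qed
  have "(\<lambda>n. L_fun k (real n)) \<in> \<Theta>(\<lambda>n. 2 ^ c_num n k)"
  proof (rule bigthetaI)
    show "(\<lambda>n. L_fun k (real n)) \<in> O(\<lambda>n. 2 ^ c_num n k)"
      using two_low by (intro bigoI[of _ 32]) (simp add: l)
    have "1 / real K * norm ((2::real) ^ c_num n k) \<le> norm (L_fun k (real n))" if "1 \<le> l n" for n
      using two_up[OF that] by (simp add: l K_def field_simps)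
    then show "(\<lambda>n. L_fun k (real n)) \<in> \<Omega>(\<lambda>n. 2 ^ c_num n k)"
      by (intro landau_omega.bigI[of "1 / real K"] eventually_mono[OF large[of 1]]) (simp_all add: K_def)
  qed
  then have "(\<lambda>n. real_of_int (f_num n k)) \<in> \<Theta>(\<lambda>n. 2 ^ c_num n k)"
    using f_theta landau_theta.trans by blast
  moreover have "(\<lambda>n. real (c_num n k) - log 2 (L_fun k (real n))) \<in> O(\<lambda>_. 1)"
  proof -
    have "norm (real (c_num n k) - log 2 (L_fun k (real n))) \<le> max 5 (log 2 (real K)) * norm (1::real)"
      if "1 \<le> l n" for n
    proof -
      have "log 2 (2 ^ c_num n k) \<le> log 2 (real K * real (l n))"
        using two_up[OF that] that by (subst log_le_cancel_iff) (auto simp: K_def)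
      also have "\<dots> = log 2 (real K) + log 2 (real (l n))" using that by (subst log_mult) (auto simp: K_def)
      finally have up: "real (c_num n k) \<le> log 2 (real K) + log 2 (real (l n))" by (simp add: log_nat_power)
      have "log 2 (real (l n)) \<le> log 2 (2 ^ (c_num n k + 5))"
        using two_low[of n] that by (subst log_le_cancel_iff) (auto simp: power_add)
      also have "\<dots> = real (c_num n k + 5)" by (subst log_nat_power) auto
      finally have low: "log 2 (real (l n)) \<le> real (c_num n k) + 5" by simp
      show ?thesis using up low by (simp add: l abs_le_iff max_def)
    qed
    then show ?thesis
      using large[of 1] by (intro bigoI[of _ "max 5 (log 2 (real K))"]) (auto elim: eventually_mono)
  qed
  ultimately show ?thesis using f_theta by blast
qed

end
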